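(* Let $(a_n)_{n \geq 1}$ be a strictly increasing sequence of positive integers with $a_n \ll e^{\gamma (\log n)^2}$ for some $\gamma > 0$. Assume furthermore that $E(\{a_1, \ldots, a_N\}) \ll N^{\kappa}$ for some $\kappa \in [2,3]$, where $E$ denotes the additive energy. Then for (Lebesgue) almost all $\alpha \in \mathbb{R}$ the star-discrepancy $D_N^* = D_N^*(\{a_1\alpha\}, \ldots, \{a_N\alpha\})$ of the sequence $(\{a_n \alpha\})_{n \geq 1}$ satisfies $$N D_N^* = \Omega\left(N^{\frac{3-\kappa}{2} - \varepsilon}\right) \quad \text{for all } \varepsilon > 0.$$
   Context: $\{x\}$ denotes the fractional part of a real number $x$. For points $x_1, \ldots, x_N \in [0,1)$ the star-discrepancy is $D_N^*(x_1,\ldots,x_N) := \sup_{0 < \beta \leq 1} \left| \frac{A_N(\beta)}{N} - \beta \right|$, where $A_N(\beta) := \#\{1 \leq n \leq N : x_n \in [0,\beta)\}$. The additive energy of a finite set $A$ of integers is $E(A) := \#\{(x_1,x_2,x_3,x_4) \in A^4 : x_1 - x_2 = x_3 - x_4\}$. For nonnegative quantities, $f(N) \ll g(N)$ means that there is a constant $C$ with $f(N) \leq C g(N)$ for all $N \ge 1$, and $f(N) = \Omega(g(N))$ means that there is a constant $c > 0$ with $f(N) \geq c\, g(N)$ for infinitely many $N$. *)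

theory Defs
  imports "HOL-Analysis.Analysis"
begin

text \<open>Sequences are indexed by the positive integers; the value at index 0 is never used.\<close>

definition star_discrepancy :: "nat \<Rightarrow> (nat \<Rightarrow> real) \<Rightarrow> real" where
  "star_discrepancy N x =
     (SUP \<beta>\<in>{0<..1}. \<bar>real (card {n \<in> {1..N}. x n \<in> {0..<\<beta>}}) / real N - \<beta>\<bar>)"

definition additive_energy :: "int set \<Rightarrow> nat" where
  "additive_energy A =
     card {(x1, x2, x3, x4). x1 \<in> A \<and> x2 \<in> A \<and> x3 \<in> A \<and> x4 \<in> A \<and> x1 - x2 = x3 - x4}"

text \<open>The Vinogradov symbol is required at every index from 1 on, not only eventually.\<close>

definition vinogradov_le :: "(nat \<Rightarrow> real) \<Rightarrow> (nat \<Rightarrow> real) \<Rightarrow> bool" where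
  "vinogradov_le f g \<longleftrightarrow> (\<exists>C. \<forall>N\<ge>1. f N \<le> C * g N)"

text \<open>The lower bound is only required infinitely often (Hardy--Littlewood), unlike the
  eventual lower bound of \<open>HOL-Library.Landau_Symbols\<close>.\<close>

definition omega_infinitely_often :: "(nat \<Rightarrow> real) \<Rightarrow> (nat \<Rightarrow> real) \<Rightarrow> bool" where
  "omega_infinitely_often f g \<longleftrightarrow> (\<exists>c>0. \<exists>\<^sub>\<infinity>N. f N \<ge> c * g N)"

end

theory Submission
  imports Defs "HOL-Computational_Algebra.Primes" "HOL-Real_Asymp.Real_Asymp"
begin

text \<open>Let \<open>S(\<alpha>) = \<Sum>n\<le>N. e(a\<^sub>n \<alpha>)\<close>, so that \<open>|S(h \<alpha>)| \<le> 2 \<pi> h N D\<^sub>N\<^sup>*(\<alpha>)\<close> for every \<open>h \<ge> 1\<close>.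
  The second moment of \<open>S\<close> is \<open>N\<close> and the fourth is the additive energy, so a dyadic pigeonholing yields a
  level \<open>|S|\<^sup>2 \<approx> N\<^sup>2 / R\<close> of measure \<open>p\<close> with \<open>p \<ge> R / N\<close> and \<open>R \<ge> N powr (3 - \<kappa>)\<close>, up to logarithms.
  A trigonometric polynomial in \<open>\<alpha>\<close> serves as a smooth indicator of that level. Its dilates by primes
  \<open>h\<close> are nearly uncorrelated, because a frequency of size at most \<open>exp (O((log N)\<^sup>2))\<close> has only
  \<open>O((log N)\<^sup>2)\<close> prime factors. By Chebyshev's inequality, outside a small set of \<open>\<alpha>\<close> some
  prime \<open>h \<le> N powr \<eta> / p\<close> has \<open>|S(h \<alpha>)|\<close> at that level, and dividing by \<open>h\<close> gives
  \<open>N D\<^sub>N\<^sup>* \<ge> N p / \<surd>R \<ge> N powr ((3 - \<kappa>) / 2)\<close> up to factors \<open>N powr O(\<eta>)\<close>.\<close>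

section \<open>Exponential sums and trigonometric polynomials\<close>

definition unit_exp :: "real \<Rightarrow> complex" where
  "unit_exp x = cis (2 * pi * x)"

lemma unit_exp_add: "unit_exp (x + y) = unit_exp x * unit_exp y"
  by (simp add: unit_exp_def cis_mult ring_distribs)

lemma cnj_unit_exp: "cnj (unit_exp x) = unit_exp (- x)"
  by (simp add: unit_exp_def cis_cnj)

lemma unit_exp_diff: "unit_exp (x - y) = unit_exp x * cnj (unit_exp y)"
  using unit_exp_add[of x "- y"] by (simp add: cnj_unit_exp)

lemma unit_exp_0 [simp]: "unit_exp 0 = 1"
  by (simp add: unit_exp_def)

lemma norm_unit_exp [simp]: "cmod (unit_exp x) = 1"
  by (simp add: unit_exp_def)

lemma unit_exp_int [simp]: "unit_exp (of_int m) = 1"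
  by (simp add: unit_exp_def cis_multiple_2pi)

lemma continuous_on_unit_exp [continuous_intros]:
  "continuous_on S f \<Longrightarrow> continuous_on S (\<lambda>x. unit_exp (f x))"
  unfolding unit_exp_def by (intro continuous_intros)

lemma has_vector_derivative_unit_exp:
  "((\<lambda>x. unit_exp (c * x)) has_vector_derivative (2 * pi * c * \<i> * unit_exp (c * x))) (at x within S)"
proof -
  have eq: "unit_exp (c * x) = exp (x *\<^sub>R (2 * pi * c * \<i>))" for x
    by (simp add: unit_exp_def cis_conv_exp scaleR_conv_of_real mult_ac)
  show ?thesis
    using exp_scaleR_has_vector_derivative_right[of "2 * pi * c * \<i>" x S] unfolding eq
    by (simp add: mult.commute)
qed

text \<open>The left end \<open>t\<close> stays free because the real line is later covered by the
  intervals between consecutive integers; the integer frequencies are orthonormal on each of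
  them.\<close>

abbreviation unit_interval_from :: "real \<Rightarrow> real measure" where
  "unit_interval_from t \<equiv> lebesgue_on {t..t + 1}"

lemma measure_unit_interval_from: "measure (unit_interval_from t) {t..t + 1} = 1"
  by (subst measure_restrict_space) auto

lemma finite_measure_unit_interval_from: "finite_measure (unit_interval_from t)"
  by (simp add: finite_measure_lebesgue_on)

lemma integrable_unit_interval_from:
  fixes f :: "real \<Rightarrow> 'b::euclidean_space"
  shows "continuous_on UNIV f \<Longrightarrow> integrable (unit_interval_from t) f"
  by (meson continuous_imp_integrable_real continuous_on_subset subset_UNIV)

lemma integral_unit_exp:
  "(LINT x|unit_interval_from t. unit_exp (of_int m * x)) = (if m = 0 then 1 else 0)"
proof (cases "m = 0")
  case True
  then show ?thesis
    using measure_unit_interval_from[of t] by simp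
next
  case False
  define F where "F = (\<lambda>x. unit_exp (of_int m * x) / (2 * pi * of_int m * \<i>))"
  have "((\<lambda>x. unit_exp (of_int m * x)) has_integral (F (t + 1) - F t)) {t..t + 1}"
  proof (rule fundamental_theorem_of_calculus)
    fix x assume "x \<in> {t..t + 1}"
    have "((\<lambda>x. unit_exp (of_int m * x) * (1 / (2 * pi * of_int m * \<i>))) has_vector_derivative
        (2 * pi * of_int m * \<i> * unit_exp (of_int m * x)) * (1 / (2 * pi * of_int m * \<i>))) (at x within {t..t + 1})"
      using has_vector_derivative_unit_exp[of "of_int m" x "{t..t+1}"]
      by (intro bounded_linear.has_vector_derivative[OF bounded_linear_mult_left]) simp
    then show "(F has_vector_derivative unit_exp (of_int m * x)) (at x within {t..t + 1})"
      using False by (simp add: F_def)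
  qed simp
  moreover have "F (t + 1) = F t"
    by (simp add: F_def ring_distribs unit_exp_add)
  ultimately have "integral {t..t + 1} (\<lambda>x. unit_exp (of_int m * x)) = 0"
    by (simp add: integral_unique)
  moreover have "integrable (unit_interval_from t) (\<lambda>x. unit_exp (of_int m * x))"
    by (intro integrable_unit_interval_from continuous_intros)
  ultimately show ?thesis
    using False by (simp add: lebesgue_integral_eq_integral)
qed

text \<open>The frequency map \<open>m\<close> need not be injective. Its coincidences are what is
  counted later: \<open>a + b\<close> is the frequency of a pair in the additive energy, and
  \<open>p * n\<close> that of a term of a dilate.\<close>

lemma parseval:
  fixes c :: "'i \<Rightarrow> complex" and m :: "'i \<Rightarrow> int"
  assumes "finite I"
  shows "complex_of_real (LINT x|unit_interval_from t. (cmod (\<Sum>i\<in>I. c i * unit_exp (of_int (m i) * x)))\<^sup>2)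
     = (\<Sum>i\<in>I. \<Sum>j\<in>I. if m i = m j then c i * cnj (c j) else 0)"
proof -
  have sq: "complex_of_real ((cmod (\<Sum>i\<in>I. c i * unit_exp (of_int (m i) * x)))\<^sup>2)
     = (\<Sum>i\<in>I. \<Sum>j\<in>I. c i * cnj (c j) * unit_exp (of_int (m i - m j) * x))" for x
  proof -
    have *: "unit_exp (of_int (m i - m j) * x) = unit_exp (of_int (m i) * x) * cnj (unit_exp (of_int (m j) * x))" for i j
      by (simp add: left_diff_distrib unit_exp_diff)
    show ?thesis
      unfolding complex_norm_square cnj_sum sum_product * by (intro sum.cong refl) (simp add: mult_ac)
  qed
  have int: "integrable (unit_interval_from t) (\<lambda>x. c * unit_exp (of_int k * x))" for c k
    by (intro integrable_unit_interval_from continuous_intros)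
  have "complex_of_real (LINT x|unit_interval_from t. (cmod (\<Sum>i\<in>I. c i * unit_exp (of_int (m i) * x)))\<^sup>2)
     = (LINT x|unit_interval_from t. (\<Sum>i\<in>I. \<Sum>j\<in>I. c i * cnj (c j) * unit_exp (of_int (m i - m j) * x)))"
    by (subst integral_complex_of_real[symmetric]) (simp only: sq)
  also have "\<dots> = (\<Sum>i\<in>I. \<Sum>j\<in>I. LINT x|unit_interval_from t. c i * cnj (c j) * unit_exp (of_int (m i - m j) * x))"
    by (subst Bochner_Integration.integral_sum Bochner_Integration.integrable_sum; (intro Bochner_Integration.integrable_sum int)?)+
       (rule refl)
  also have "\<dots> = (\<Sum>i\<in>I. \<Sum>j\<in>I. if m i = m j then c i * cnj (c j) else 0)"
    using integral_unit_exp[of t "_ - _"]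
    by (intro sum.cong refl) (auto simp del: of_int_diff simp: integral_unit_exp)
  finally show ?thesis .
qed

section \<open>Trigonometric polynomials of bounded degree\<close>

text \<open>What matters later is the degree bound \<open>D\<close>, which enters the variance
  estimate through \<open>log 2 D\<close>. Real functions are embedded by
  \<open>complex_of_real\<close>.\<close>

definition trig_poly :: "nat \<Rightarrow> (real \<Rightarrow> complex) \<Rightarrow> bool" where
  "trig_poly D f \<longleftrightarrow> (\<exists>c. \<forall>x. f x = (\<Sum>n\<in>{- int D..int D}. c n * unit_exp (of_int n * x)))"

text \<open>Coefficients that share a frequency are added up, so products and moduli squared can be
  presented by sums over pairs.\<close>

lemma trig_polyI:
  fixes m :: "'i \<Rightarrow> int"
  assumes "finite I" and "\<And>i. i \<in> I \<Longrightarrow> \<bar>m i\<bar> \<le> int D"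
    and "\<And>x. f x = (\<Sum>i\<in>I. c i * unit_exp (of_int (m i) * x))"
  shows "trig_poly D f"
  unfolding trig_poly_def
proof (intro exI allI)
  fix x
  have "m ` I \<subseteq> {- int D..int D}"
    using assms(2) by force
  from sum.group[OF assms(1) _ this, of "\<lambda>i. c i * unit_exp (of_int (m i) * x)"]
  show "f x = (\<Sum>n\<in>{- int D..int D}. (\<Sum>i\<in>{i \<in> I. m i = n}. c i) * unit_exp (of_int n * x))"
    by (simp add: assms(3) sum_distrib_right)
qed

lemma trig_poly_mult:
  assumes "trig_poly D f" and "trig_poly E g"
  shows "trig_poly (D + E) (\<lambda>x. f x * g x)"
proof -
  obtain c where c: "\<And>x. f x = (\<Sum>n\<in>{- int D..int D}. c n * unit_exp (of_int n * x))"
    using assms(1) unfolding trig_poly_def by blast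
  obtain d where d: "\<And>x. g x = (\<Sum>n\<in>{- int E..int E}. d n * unit_exp (of_int n * x))"
    using assms(2) unfolding trig_poly_def by blast
  show ?thesis
    by (rule trig_polyI[where I = "{- int D..int D} \<times> {- int E..int E}" and m = "\<lambda>(i,j). i + j"
          and c = "\<lambda>(i,j). c i * d j"])
       (auto simp: c d sum_product sum.cartesian_product unit_exp_add ring_distribs mult_ac intro!: sum.cong)
qed

lemma trig_poly_add:
  assumes "trig_poly D f" and "trig_poly D g"
  shows "trig_poly D (\<lambda>x. f x + g x)"
proof -
  obtain c where c: "\<And>x. f x = (\<Sum>n\<in>{- int D..int D}. c n * unit_exp (of_int n * x))"
    using assms(1) unfolding trig_poly_def by blast
  obtain d where d: "\<And>x. g x = (\<Sum>n\<in>{- int D..int D}. d n * unit_exp (of_int n * x))"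
    using assms(2) unfolding trig_poly_def by blast
  show ?thesis
    by (rule trig_polyI[where I = "{- int D..int D}" and m = "\<lambda>i. i" and c = "\<lambda>i. c i + d i"])
       (auto simp: c d ring_distribs sum.distrib)
qed

lemma trig_poly_const: "trig_poly D (\<lambda>x. c)"
  by (rule trig_polyI[where I = "{0::int}" and m = "\<lambda>i. i" and c = "\<lambda>i. c"]) auto

lemma trig_poly_power:
  assumes "trig_poly D f"
  shows "trig_poly (k * D) (\<lambda>x. f x ^ k)"
proof (induction k)
  case 0
  then show ?case using trig_poly_const[of 0 1] by simp
next
  case (Suc k)
  then show ?case using trig_poly_mult[OF assms Suc] by simp
qed

section \<open>Moments of the exponential sum\<close>

definition exp_sum :: "int set \<Rightarrow> real \<Rightarrow> complex" where
  "exp_sum A x = (\<Sum>a\<in>A. unit_exp (of_int a * x))"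

lemma continuous_on_exp_sum [continuous_intros]:
  "continuous_on S f \<Longrightarrow> continuous_on S (\<lambda>x. exp_sum A (f x))"
  unfolding exp_sum_def by (intro continuous_intros)

lemma norm_exp_sum_le: "cmod (exp_sum A x) \<le> card A"
  unfolding exp_sum_def by (rule order_trans[OF norm_sum]) simp

lemma exp_sum_second_moment:
  assumes "finite A"
  shows "(LINT x|unit_interval_from t. (cmod (exp_sum A x))\<^sup>2) = card A"
proof -
  have "complex_of_real (LINT x|unit_interval_from t. (cmod (exp_sum A x))\<^sup>2) = of_nat (card A)"
    using parseval[OF assms, of t "\<lambda>_. 1" "\<lambda>a. a"] assms
    by (simp add: exp_sum_def)
  then show ?thesis
    by (metis of_real_eq_iff of_real_of_nat_eq)
qed

lemma exp_sum_fourth_moment: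
  assumes "finite A"
  shows "(LINT x|unit_interval_from t. (cmod (exp_sum A x)) ^ 4) = additive_energy A"
proof -
  let ?m = "\<lambda>(a, b). a + b :: int"
  let ?Q = "{(p, q) \<in> (A \<times> A) \<times> (A \<times> A). ?m p = ?m q}"
  have fin: "finite (A \<times> A)" using assms by simp
  \<comment> \<open>Squaring turns the fourth moment of the sum over \<open>A\<close> into a second
    moment of a sum over pairs, to which Parseval applies.\<close>
  have sq: "exp_sum A x ^ 2 = (\<Sum>p\<in>A \<times> A. 1 * unit_exp (of_int (?m p) * x))" for x
    by (simp add: exp_sum_def power2_eq_square sum_product sum.cartesian_product unit_exp_add ring_distribs
        case_prod_beta)
  have "(cmod (exp_sum A x)) ^ 4 = (cmod (\<Sum>p\<in>A \<times> A. 1 * unit_exp (of_int (?m p) * x)))\<^sup>2" for x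
    unfolding sq[symmetric] by (simp add: norm_power)
  then have "complex_of_real (LINT x|unit_interval_from t. (cmod (exp_sum A x)) ^ 4)
      = (\<Sum>p\<in>A \<times> A. \<Sum>q\<in>A \<times> A. if ?m p = ?m q then 1 * cnj 1 else 0)"
    using parseval[OF fin, of t "\<lambda>_. 1" ?m] by simp
  also have "\<dots> = (\<Sum>r\<in>(A \<times> A) \<times> (A \<times> A). if ?m (fst r) = ?m (snd r) then 1 else 0)"
    by (subst sum.cartesian_product) (simp add: case_prod_beta cong: if_cong)
  also have "\<dots> = of_nat (card {r \<in> (A \<times> A) \<times> (A \<times> A). ?m (fst r) = ?m (snd r)})"
    using assms by (subst sum.inter_filter[symmetric]) auto
  \<comment> \<open>Parseval counts \<open>a + b = c + d\<close>, the energy counts equal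
    differences; rewriting the equation as \<open>a - c = d - b\<close> gives the bijection.\<close>
  also have "card {r \<in> (A \<times> A) \<times> (A \<times> A). ?m (fst r) = ?m (snd r)} = additive_energy A"
    unfolding additive_energy_def
    by (rule bij_betw_same_card[of "\<lambda>((a, b), (c, d)). (a, c, d, b)"],
        rule bij_betw_byWitness[where f' = "\<lambda>(a, c, d, b). ((a, b), (c, d))"]) auto
  finally show ?thesis
    by (metis of_real_eq_iff of_real_of_nat_eq)
qed

text \<open>The frequencies are differences of two elements of \<open>[0, D]\<close>, so the degree
  does not double.\<close>

lemma trig_poly_norm_exp_sum_sq:
  assumes "finite A" and "\<And>a. a \<in> A \<Longrightarrow> 0 \<le> a \<and> a \<le> int D"
  shows "trig_poly D (\<lambda>x. complex_of_real ((cmod (exp_sum A x))\<^sup>2))"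
proof (rule trig_polyI[where I = "A \<times> A" and m = "\<lambda>(a, b). a - b" and c = "\<lambda>_. 1"])
  fix x
  have *: "unit_exp (of_int (a - b) * x) = unit_exp (of_int a * x) * cnj (unit_exp (of_int b * x))" for a b
    by (simp add: left_diff_distrib unit_exp_diff)
  show "complex_of_real ((cmod (exp_sum A x))\<^sup>2)
      = (\<Sum>p\<in>A \<times> A. 1 * unit_exp (of_int (case p of (a, b) \<Rightarrow> a - b) * x))"
    unfolding complex_norm_square exp_sum_def cnj_sum sum_product
    by (subst sum.cartesian_product) (intro sum.cong refl, clarsimp simp: * simp del: of_int_diff)
next
  fix p assume "p \<in> A \<times> A"
  then show "\<bar>case p of (a, b) \<Rightarrow> a - b\<bar> \<le> int D"
    using assms(2)[of "fst p"] assms(2)[of "snd p"] by (auto simp: abs_le_iff)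
qed (simp add: assms(1))

section \<open>Prime numbers\<close>

text \<open>The Leibniz triangle \<open>1 / (m * (n choose m))\<close> has the difference structure of the Beta
  integrals \<open>\<integral> x^(m-1) (1-x)^(n-m)\<close>, which keeps its denominators inside \<open>lcm(1..n)\<close>.\<close>

lemma binomial_times_dvd_Lcm:
  fixes L :: nat
  assumes "1 \<le> m" and "m \<le> n" and "\<forall>j\<in>{1..n}. j dvd L"
  shows "m * (n choose m) dvd L"
  using assms
proof (induction "n - m" arbitrary: m n)
  case 0
  then show ?case by auto
next
  case (Suc d)
  then obtain n' where n: "n = Suc n'" "m \<le> n'" "d = n' - m"
    by (cases n) auto
  have 1: "m * (n' choose m) dvd L"
    using Suc.hyps(1)[of n' m] Suc.prems n by auto
  have 2: "Suc m * (n choose Suc m) dvd L"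
    using Suc.hyps(1)[of n "Suc m"] Suc.prems n by auto
  have e1: "Suc m * (n choose Suc m) = (n - m) * (n choose m)"
    using binomial_absorption[of m n] binomial_absorb_comp[of n m] n by simp
  have e2: "(n - m) * (n choose m) = n * (n' choose m)"
    using binomial_absorb_comp[of n m] n by simp
  obtain x where x: "L = m * (n' choose m) * x" using 1 by blast
  obtain y where y: "L = n * (n' choose m) * y" using 2 e1 e2 by (metis dvdE)
  have pos: "n' choose m > 0" using n by simp
  have xy: "m * x = n * y" using x y pos by (simp add: mult.commute mult.left_commute)
  have nx: "L * n = m * (n choose m) * (n - m) * x"
    using x e2 by (metis mult.assoc mult.commute)
  \<comment> \<open>This is the triangle identity 1/(m C(n,m)) = 1/(m C(n-1,m)) - 1/((m+1)
    C(n,m+1)), multiplied by \<open>L\<close>, with \<open>x\<close> and \<open>y\<close> the two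
    quotients on the right. The extra factor \<open>n\<close> keeps the computation in the natural
    numbers.\<close>
  have "m * (n choose m) * (x - y) * n = m * (n choose m) * (n * x - m * x)"
    using xy by (simp add: algebra_simps diff_mult_distrib2)
  also have "\<dots> = m * (n choose m) * ((n - m) * x)" by (simp add: diff_mult_distrib)
  also have "\<dots> = L * n" using nx by simp
  finally have "m * (n choose m) * (x - y) = L" using n(1) by (subst (asm) mult_right_cancel) auto
  then show ?case by (metis dvd_triv_left)
qed

text \<open>Each prime up to \<open>n\<close> contributes to the lcm a power that divides some
  \<open>j\<close> in \<open>{1..n}\<close>, hence a factor of at most \<open>n\<close>.\<close>

lemma Lcm_le_power_prime_count:
  fixes n :: nat
  assumes "n \<ge> 1"
  shows "Lcm {1..n} \<le> n ^ card {p. prime p \<and> p \<le> n}"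
proof -
  define L where "L = Lcm {1..n}"
  have L0: "L \<noteq> 0" unfolding L_def by (subst Lcm_0_iff) auto
  define P where "P = {p. prime p \<and> p \<le> n}"
  have finP: "finite P" unfolding P_def by simp
  define ex where "ex = (\<lambda>p. Max ((multiplicity p) ` {1..n}))"
  have exle: "p ^ ex p \<le> n" if "p \<in> P" for p
  proof -
    have "ex p \<in> (multiplicity p) ` {1..n}"
      unfolding ex_def using assms by (intro Max_in) auto
    then obtain j where "j \<in> {1..n}" "ex p = multiplicity p j" by auto
    then show ?thesis
      by (metis atLeastAtMost_iff dvd_imp_le le_trans multiplicity_dvd not_one_le_zero gr0I)
  qed
  define Q where "Q = (\<Prod>p\<in>P. p ^ ex p)"
  have Q0: "Q > 0" unfolding Q_def P_def by (intro prod_pos) (auto simp: prime_gt_0_nat)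
  have "j dvd Q" if j: "j \<in> {1..n}" for j
  proof (rule multiplicity_le_imp_dvd)
    fix p :: nat assume p: "prime p"
    show "multiplicity p j \<le> multiplicity p Q"
    proof (cases "p \<in> P")
      case True
      have "p ^ ex p dvd Q" unfolding Q_def using True finP by (intro dvd_prodI)
      then have "ex p \<le> multiplicity p Q" using Q0 p
        by (intro multiplicity_geI) (auto simp: prime_gt_1_nat)
      moreover have "multiplicity p j \<le> ex p" unfolding ex_def using j by (intro Max_ge) auto
      ultimately show ?thesis by simp
    next
      case False
      then have "\<not> p dvd j" using p j unfolding P_def by (auto dest: dvd_imp_le)
      then show ?thesis by (simp add: not_dvd_imp_multiplicity_0)
    qed
  qed (use j in auto)
  then have "L dvd Q" unfolding L_def by (intro Lcm_least) auto
  then have "L \<le> Q" using Q0 by (simp add: dvd_imp_le)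
  also have "Q \<le> (\<Prod>p\<in>P. n)" unfolding Q_def using exle by (intro prod_mono) auto
  finally show ?thesis unfolding L_def P_def by simp
qed

text \<open>Chebyshev's lower bound by Nair's argument. With \<open>m = n div 2\<close>, the number
  m C(2m,m) is at least 4^m / 2 and divides lcm(1..n), which is at most \<open>n\<close> to the
  power of the number of primes; taking logarithms gives the claim.\<close>

lemma prime_count_lower_bound:
  fixes n :: nat
  assumes "n \<ge> 4"
  shows "real (card {p. prime p \<and> p \<le> n}) \<ge> real n / (4 * ln (real n))"
proof -
  define m where "m = n div 2"
  have m: "m \<ge> 2" "2 * m \<le> n" "n \<le> 2 * m + 1" unfolding m_def using assms by auto
  have "m * (2 * m choose m) dvd Lcm {1..n}"
    using m by (intro binomial_times_dvd_Lcm) (auto intro: dvd_Lcm)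
  moreover have "Lcm {1..n} > 0" 
    by (metis Lcm_0_iff atLeastAtMost_iff finite_atLeastAtMost gr0I not_one_le_zero)
  ultimately have "m * (2 * m choose m) \<le> Lcm {1..n}" by (rule dvd_imp_le)
  also have "\<dots> \<le> n ^ card {p. prime p \<and> p \<le> n}"
    using assms by (intro Lcm_le_power_prime_count) auto
  finally have "real m * real (2 * m choose m) \<le> real n ^ card {p. prime p \<and> p \<le> n}"
    by (metis of_nat_le_iff of_nat_mult of_nat_power)
  moreover have "4 ^ m / (2 * real m) \<le> real (2 * m choose m)"
    using m by (intro central_binomial_lower_bound) auto
  then have "real m * (4 ^ m / (2 * real m)) \<le> real m * real (2 * m choose m)"
    by (intro mult_left_mono) auto
  ultimately have "4 ^ m / 2 \<le> real n ^ card {p. prime p \<and> p \<le> n}" using m by simp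
  then have "ln (4 ^ m / 2) \<le> ln (real n ^ card {p. prime p \<and> p \<le> n})"
    using assms by (subst ln_le_cancel_iff) auto
  moreover have "ln (4 ^ m / 2) = (2 * real m - 1) * ln 2"
  proof -
    have "ln (4::real) = 2 * ln 2" using ln_realpow[of 2 2] by simp
    then show ?thesis by (simp add: ln_div ln_realpow algebra_simps)
  qed
  moreover have "(2 * real m - 1) * ln 2 \<ge> (2 * real m - 1) * (1/2)"
    using m ln2_ge_two_thirds by (intro mult_left_mono) auto
  moreover have "(2 * real m - 1) * (1/2) \<ge> real n / 4"
  proof -
    have "n \<le> 2*m+1" "4 \<le> n" "2 \<le> m" using m assms by auto
    then have "real n \<le> 2 * real m + 1" "2 \<le> real m" by linarith+
    moreover have "real m * 2 \<ge> real n - 1" using m by linarith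
    ultimately show ?thesis
      using assms m by (cases "m = 2") auto
  qed
  moreover have "ln (real n ^ card {p. prime p \<and> p \<le> n}) = real (card {p. prime p \<and> p \<le> n}) * ln (real n)"
    by (rule ln_realpow)
  ultimately have "real n / 4 \<le> real (card {p. prime p \<and> p \<le> n}) * ln (real n)"
    by linarith
  moreover have "ln (real n) > 0" using assms by simp
  ultimately show ?thesis by (simp add: field_simps)
qed

lemma card_prime_divisors_le_log:
  fixes n :: nat
  assumes "n > 0"
  shows "real (card {p. prime p \<and> p dvd n}) \<le> log 2 n"
proof -
  have eq: "{p. prime p \<and> p dvd n} = prime_factors n"
    using assms by (auto simp: prime_factors_dvd)
  have "2 ^ card (prime_factors n) = (\<Prod>p\<in>prime_factors n. 2::nat)"
    by simp
  also have "\<dots> \<le> (\<Prod>p\<in>prime_factors n. p ^ multiplicity p n)"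
  proof (intro prod_mono conjI)
    fix p assume p: "p \<in> prime_factors n"
    then have "p ^ 1 \<le> p ^ multiplicity p n"
      using assms by (intro power_increasing) (auto simp: prime_factors_multiplicity prime_gt_0_nat Suc_le_eq)
    then show "2 \<le> p ^ multiplicity p n"
      using p prime_ge_2_nat[of p] by (auto simp: prime_factors_multiplicity)
  qed simp
  also have "\<dots> = n"
    using assms by (simp add: prime_factorization_nat[symmetric])
  finally have "2 ^ card (prime_factors n) \<le> real n"
    by (metis of_nat_le_iff of_nat_numeral of_nat_power)
  then show ?thesis
    using assms by (simp add: eq le_log_iff powr_realpow)
qed

section \<open>Dilates by primes\<close>

text \<open>The correlation of the dilates by primes \<open>p\<close> and \<open>q\<close> only comes from pairs of frequencies with
  \<open>p * n = q * n'\<close>, which forces \<open>q = p\<close> or \<open>q dvd n\<close>; and \<open>n\<close> has few prime divisors.\<close>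

lemma variance_prime_dilates:
  fixes g :: "real \<Rightarrow> real"
  assumes g: "trig_poly D (\<lambda>x. complex_of_real (g x))" and "D \<ge> 1"
    and P: "finite P" "\<And>p. p \<in> P \<Longrightarrow> prime p"
  shows "(LINT x|unit_interval_from t. ((\<Sum>p\<in>P. g (real p * x)) - card P * (LINT x|unit_interval_from t. g x))\<^sup>2)
     \<le> card P * (1 + log 2 D) * (LINT x|unit_interval_from t. (g x)\<^sup>2)"
proof -
  obtain c where c: "\<And>x. complex_of_real (g x) = (\<Sum>n\<in>{- int D..int D}. c n * unit_exp (of_int n * x))"
    using g unfolding trig_poly_def by blast
  let ?M = "unit_interval_from t"
  let ?J = "{- int D..int D}"
  define \<mu> where "\<mu> = (LINT x|?M. g x)"
  have int: "integrable ?M (\<lambda>x. c * unit_exp (of_int k * x))" for c k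
    by (intro integrable_unit_interval_from continuous_intros)
  have "complex_of_real \<mu> = (LINT x|?M. (\<Sum>n\<in>?J. c n * unit_exp (of_int n * x)))"
    unfolding \<mu>_def c[symmetric] by (rule integral_complex_of_real[symmetric])
  also have "\<dots> = (\<Sum>n\<in>?J. LINT x|?M. c n * unit_exp (of_int n * x))"
    by (rule Bochner_Integration.integral_sum) (rule int)
  also have "\<dots> = (\<Sum>n\<in>?J. if n = 0 then c n else 0)"
    by (intro sum.cong refl) (simp add: integral_unit_exp)
  also have "\<dots> = c 0"
    by (simp add: sum.delta)
  finally have mu: "complex_of_real \<mu> = c 0" .
  \<comment> \<open>Subtracting the mean removes the zero frequency. The remaining \<open>n\<close>
    are nonzero and so have few prime divisors.\<close>
  define I where "I = P \<times> (?J - {0})"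
  define m where "m = (\<lambda>(p, n). int p * n)"
  define d where "d = (\<lambda>i::nat\<times>int. c (snd i))"
  have finI: "finite I" using P by (simp add: I_def)
  have Y: "complex_of_real ((\<Sum>p\<in>P. g (real p * x)) - card P * \<mu>)
      = (\<Sum>i\<in>I. d i * unit_exp (of_int (m i) * x))" for x
  proof -
    have "complex_of_real (g (real p * x)) - complex_of_real \<mu>
        = (\<Sum>n\<in>?J - {0}. c n * unit_exp (of_int (int p * n) * x))" for p
      unfolding c mu by (subst sum.remove[of _ 0]) (auto simp: mult_ac)
    then have "(\<Sum>p\<in>P. complex_of_real (g (real p * x)) - complex_of_real \<mu>)
        = (\<Sum>p\<in>P. \<Sum>n\<in>?J - {0}. c n * unit_exp (of_int (int p * n) * x))"
      by simp
    then show ?thesis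
      unfolding I_def m_def d_def by (subst (asm) sum.cartesian_product) (simp add: sum_subtractf case_prod_beta)
  qed
  have "complex_of_real (LINT x|?M. ((\<Sum>p\<in>P. g (real p * x)) - card P * \<mu>)\<^sup>2)
      = complex_of_real (LINT x|?M. (cmod (\<Sum>i\<in>I. d i * unit_exp (of_int (m i) * x)))\<^sup>2)"
    unfolding Y[symmetric] norm_of_real by simp
  also have "\<dots> = (\<Sum>i\<in>I. \<Sum>j\<in>I. if m i = m j then d i * cnj (d j) else 0)"
    by (rule parseval[OF finI])
  finally have V: "complex_of_real (LINT x|?M. ((\<Sum>p\<in>P. g (real p * x)) - card P * \<mu>)\<^sup>2)
     = (\<Sum>i\<in>I. \<Sum>j\<in>I. if m i = m j then d i * cnj (d j) else 0)" .
  have "(LINT x|?M. ((\<Sum>p\<in>P. g (real p * x)) - card P * \<mu>)\<^sup>2)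
      \<le> cmod (complex_of_real (LINT x|?M. ((\<Sum>p\<in>P. g (real p * x)) - card P * \<mu>)\<^sup>2))"
    unfolding norm_of_real by (rule abs_ge_self)
  \<comment> \<open>By AM-GM the products become sums of squares; after symmetrisation only the
    number of partners \<open>j\<close> with the same frequency as \<open>i\<close> matters.\<close>
  also have "\<dots> \<le> (\<Sum>i\<in>I. \<Sum>j\<in>I. if m i = m j then ((cmod (d i))\<^sup>2 + (cmod (d j))\<^sup>2) / 2 else 0)"
    unfolding V
  proof (intro sum_norm_le)
    fix i j
    have "cmod (d i) * cmod (d j) \<le> ((cmod (d i))\<^sup>2 + (cmod (d j))\<^sup>2) / 2"
      using sum_squares_bound[of "cmod (d i)" "cmod (d j)"] by simp
    then show "cmod (if m i = m j then d i * cnj (d j) else 0)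
        \<le> (if m i = m j then ((cmod (d i))\<^sup>2 + (cmod (d j))\<^sup>2) / 2 else 0)"
      by (simp add: norm_mult)
  qed
  also have "\<dots> = (\<Sum>i\<in>I. \<Sum>j\<in>I. if m i = m j then (cmod (d i))\<^sup>2 / 2 else 0)
      + (\<Sum>i\<in>I. \<Sum>j\<in>I. if m i = m j then (cmod (d j))\<^sup>2 / 2 else 0)"
    unfolding sum.distrib[symmetric] by (intro sum.cong refl) (simp add: add_divide_distrib)
  also have "(\<Sum>i\<in>I. \<Sum>j\<in>I. if m i = m j then (cmod (d j))\<^sup>2 / 2 else 0)
      = (\<Sum>i\<in>I. \<Sum>j\<in>I. if m i = m j then (cmod (d i))\<^sup>2 / 2 else 0)"
    by (subst sum.swap) (intro sum.cong refl, auto)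
  also have "(\<Sum>i\<in>I. \<Sum>j\<in>I. if m i = m j then (cmod (d i))\<^sup>2 / 2 else 0)
       + (\<Sum>i\<in>I. \<Sum>j\<in>I. if m i = m j then (cmod (d i))\<^sup>2 / 2 else 0)
      = (\<Sum>i\<in>I. card {j \<in> I. m j = m i} * (cmod (d i))\<^sup>2)"
  proof -
    have "(\<Sum>j\<in>I. if m i = m j then (cmod (d i))\<^sup>2 / 2 else 0)
        = card {j \<in> I. m j = m i} * ((cmod (d i))\<^sup>2 / 2)" for i
      using finI by (subst sum.inter_filter[symmetric]) (auto simp: eq_commute)
    then show ?thesis by (simp only:) (simp add: sum.distrib[symmetric] mult.commute)
  qed
  also have "\<dots> \<le> (\<Sum>i\<in>I. (1 + log 2 D) * (cmod (d i))\<^sup>2)"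
  proof (intro sum_mono mult_right_mono)
    fix i assume i: "i \<in> I"
    obtain p n where pn: "i = (p, n)" by force
    have n: "n \<noteq> 0" "\<bar>n\<bar> \<le> int D" and p: "p \<in> P" using i by (auto simp: I_def pn)
    let ?B = "insert p {q. prime q \<and> q dvd nat \<bar>n\<bar>}"
    have finB: "finite {q. prime q \<and> q dvd nat \<bar>n\<bar>}"
      by (rule finite_subset[OF _ finite_divisors_nat[of "nat \<bar>n\<bar>"]]) (use n in auto)
    \<comment> \<open>A partner \<open>(q, n')\<close> of \<open>(p, n)\<close> is determined by
      \<open>q\<close>, because q n' = p n; so it suffices to count first components.\<close>
    have "card {j \<in> I. m j = m i} \<le> card ?B"
    proof (rule card_inj_on_le[of fst])
      show "inj_on fst {j \<in> I. m j = m i}"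
        using P(2) by (auto simp: inj_on_def I_def m_def pn) (metis mult_cancel_left of_nat_eq_0_iff not_prime_0)
      show "fst ` {j \<in> I. m j = m i} \<subseteq> ?B"
      proof
        fix q assume "q \<in> fst ` {j \<in> I. m j = m i}"
        then obtain n' where q: "(q, n') \<in> I" "m (q, n') = m i" by auto
        then have qP: "q \<in> P" by (simp add: I_def)
        have "int q dvd int p * n" using q(2) by (metis dvd_triv_left m_def pn case_prod_conv)
        moreover have "prime (int q)" using P(2) qP by simp
        ultimately have "int q dvd int p \<or> int q dvd n" by (simp add: prime_dvd_mult_iff)
        then show "q \<in> ?B"
        proof
          assume "int q dvd int p"
          then show ?thesis using P(2) p qP by (simp add: primes_dvd_imp_eq)
        next
          assume "int q dvd n"
          then have "q dvd nat \<bar>n\<bar>" by (simp flip: int_dvd_int_iff)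
          then show ?thesis using P(2) qP by simp
        qed
      qed
      show "finite ?B" using finB by simp
    qed
    also have "\<dots> \<le> 1 + card {q. prime q \<and> q dvd nat \<bar>n\<bar>}"
      using finB by (simp add: card_insert_if)
    finally have "real (card {j \<in> I. m j = m i}) \<le> 1 + real (card {q. prime q \<and> q dvd nat \<bar>n\<bar>})"
      by linarith
    also have "\<dots> \<le> 1 + log 2 (nat \<bar>n\<bar>)"
      using card_prime_divisors_le_log[of "nat \<bar>n\<bar>"] n by simp
    also have "log 2 (nat \<bar>n\<bar>) \<le> log 2 D"
    proof -
      have "0 < real (nat \<bar>n\<bar>)" "real (nat \<bar>n\<bar>) \<le> real D" using n by linarith+
      then show ?thesis by simp
    qed
    finally show "card {j \<in> I. m j = m i} \<le> 1 + log 2 D" by simp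
  qed simp
  also have "\<dots> = (1 + log 2 D) * (\<Sum>p\<in>P. \<Sum>n\<in>?J - {0}. (cmod (c n))\<^sup>2)"
    unfolding I_def d_def by (subst sum.cartesian_product) (simp add: sum_distrib_left case_prod_beta)
  also have "\<dots> = card P * (1 + log 2 D) * (\<Sum>n\<in>?J - {0}. (cmod (c n))\<^sup>2)"
    by simp
  also have "\<dots> \<le> card P * (1 + log 2 D) * (\<Sum>n\<in>?J. (cmod (c n))\<^sup>2)"
    using \<open>D \<ge> 1\<close> by (intro mult_left_mono sum_mono2) auto
  also have "(\<Sum>n\<in>?J. (cmod (c n))\<^sup>2) = (LINT x|?M. (g x)\<^sup>2)"
  proof -
    have "complex_of_real (LINT x|?M. (cmod (complex_of_real (g x)))\<^sup>2)
        = (\<Sum>i\<in>?J. \<Sum>j\<in>?J. if i = j then c i * cnj (c j) else 0)"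
      unfolding c by (rule parseval) simp
    also have "\<dots> = complex_of_real (\<Sum>n\<in>?J. (cmod (c n))\<^sup>2)"
      by (simp add: complex_norm_square del: of_real_power)
    finally show ?thesis by (simp only: of_real_eq_iff) simp
  qed
  finally show ?thesis unfolding \<mu>_def .
qed

text \<open>Chebyshev's inequality: if no dilate exceeds \<open>\<mu> / 2\<close>, the sum of the
  dilates falls short of its mean by at least half of that mean. Since 0 <= g <= 1, the second
  moment of \<open>g\<close> is at most its mean, which leaves only one factor \<open>\<mu>\<close>
  in the denominator.\<close>

lemma prime_dilates_hit:
  fixes g :: "real \<Rightarrow> real" and \<mu> :: real
  assumes g: "trig_poly D (\<lambda>x. complex_of_real (g x))" "continuous_on UNIV g" and D: "D \<ge> 1"
    and g01: "\<And>x. 0 \<le> g x \<and> g x \<le> 1"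
    and P: "finite P" "P \<noteq> {}" "\<And>p. p \<in> P \<Longrightarrow> prime p"
    and \<mu>: "0 < \<mu>" "\<mu> \<le> (LINT x|unit_interval_from t. g x)"
  obtains B where "B \<in> sets (unit_interval_from t)"
    and "measure (unit_interval_from t) B \<le> 4 * (1 + log 2 D) / (card P * \<mu>)"
    and "\<And>x. x \<in> {t..t + 1} - B \<Longrightarrow> \<exists>p\<in>P. g (real p * x) > \<mu> / 2"
proof -
  let ?M = "unit_interval_from t"
  define m where "m = (LINT x|?M. g x)"
  have m: "m > 0" using \<mu> by (simp add: m_def)
  have cP: "real (card P) > 0" using P by (simp add: card_gt_0_iff)
  have L: "1 + log 2 D > 0" using D by (simp add: add_pos_nonneg)
  define Y where "Y = (\<lambda>x. ((\<Sum>p\<in>P. g (real p * x)) - card P * m)\<^sup>2)"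
  have contg: "continuous_on UNIV (\<lambda>x. g (real p * x))" for p
    by (rule continuous_on_compose2[OF g(2)]) (auto intro: continuous_intros)
  have intY: "integrable ?M Y"
    unfolding Y_def by (intro integrable_unit_interval_from continuous_intros contg)
  have "(LINT x|?M. (g x)\<^sup>2) \<le> m"
    unfolding m_def
    using g01 by (intro integral_mono integrable_unit_interval_from continuous_intros g(2))
      (auto simp: power2_eq_square intro: mult_left_le)
  then have "(LINT x|?M. Y x) \<le> card P * (1 + log 2 D) * m"
    using variance_prime_dilates[OF g(1) D P(1,3), of t] L cP unfolding Y_def m_def
    by (meson mult_left_mono order_trans less_imp_le mult_pos_pos)
  moreover define B where "B = {x \<in> space ?M. Y x \<ge> (card P * m / 2)\<^sup>2}"
  have "measure ?M B \<le> (LINT x|?M. Y x) / (card P * m / 2)\<^sup>2"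
    unfolding B_def
    by (rule integral_Markov_inequality_measure[OF intY, of "{}"]) (use cP m in \<open>auto simp: Y_def\<close>)
  ultimately have "measure ?M B \<le> card P * (1 + log 2 D) * m / (card P * m / 2)\<^sup>2"
    by (meson divide_right_mono order_trans zero_le_power2)
  also have "\<dots> = 4 * (1 + log 2 D) / (card P * m)"
    using cP m by (simp add: power2_eq_square field_simps)
  also have "\<dots> \<le> 4 * (1 + log 2 D) / (card P * \<mu>)"
    using cP \<mu> L m unfolding m_def by (intro divide_left_mono mult_left_mono) auto
  finally have "measure ?M B \<le> 4 * (1 + log 2 D) / (card P * \<mu>)" .
  moreover have "B \<in> sets ?M"
  proof -
    have [measurable]: "Y \<in> borel_measurable ?M" using intY by (rule borel_measurable_integrable)
    show ?thesis unfolding B_def by measurable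
  qed
  moreover have "\<exists>p\<in>P. g (real p * x) > \<mu> / 2" if x: "x \<in> {t..t + 1} - B" for x
  proof (rule ccontr)
    assume "\<not> ?thesis"
    then have "(\<Sum>p\<in>P. g (real p * x)) \<le> (\<Sum>p\<in>P. m / 2)"
      using \<mu> unfolding m_def by (intro sum_mono) (force simp: not_less)
    then have "card P * m / 2 \<le> card P * m - (\<Sum>p\<in>P. g (real p * x))"
      by (simp add: mult.commute)
    then have "(card P * m / 2)\<^sup>2 \<le> (card P * m - (\<Sum>p\<in>P. g (real p * x)))\<^sup>2"
      using cP m by (intro power_mono) auto
    then have "x \<in> B"
      using x by (simp add: B_def Y_def power2_commute)
    then show False using x by simp
  qed
  ultimately show thesis using that by blast
qed

section \<open>A polynomial bump and the level sets of the exponential sum\<close>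

text \<open>The left side is the probability of at most one success in \<open>n\<close> independent
  trials with success probability \<open>x\<close>; the induction step conditions on one
  trial.\<close>

lemma bump_le_1:
  fixes x :: real
  assumes "0 \<le> x" "x \<le> 1"
  shows "real n * x * (1 - x) ^ (n - 1) + (1 - x) ^ n \<le> 1"
proof (induction n)
  case (Suc n)
  have "real (Suc n) * x * (1 - x) ^ (Suc n - 1) + (1 - x) ^ Suc n
      = (1 - x) * (real n * x * (1 - x) ^ (n - 1) + (1 - x) ^ n) + x * (1 - x) ^ n"
    by (cases n) (simp_all add: algebra_simps)
  also have "\<dots> \<le> (1 - x) * 1 + x * 1"
    using assms Suc by (intro add_mono mult_left_mono power_le_one) auto
  finally show ?case by simp
qed simp

text \<open>The bound is the product of R x >= 1/2 and (1 - 1/R)^(R-1) >= 1/e >= 1/3. For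
  \<open>R = 1\<close> the last power is 0^0 = 1.\<close>

lemma bump_lower:
  fixes x :: real
  assumes "R \<ge> 1" "1 / (2 * real R) \<le> x" "x \<le> 1 / real R"
  shows "1 / 6 \<le> real R * x * (1 - x) ^ (R - 1)"
proof -
  have "1 / 3 \<le> (1 - 1 / real R) ^ (R - 1)"
  proof (cases "R = 1")
    case False
    define n where "n = R - 1"
    have n: "n \<ge> 1" "real R = real n + 1" using False assms by (auto simp: n_def)
    have "(1 + 1 / real n) ^ n \<le> exp (1 / real n) ^ n"
      by (intro power_mono) (auto simp: exp_ge_add_one_self)
    also have "\<dots> = exp 1" using n by (simp flip: exp_of_nat_mult)
    also have "\<dots> \<le> 3" by (rule exp_le)
    finally have "1 / 3 \<le> 1 / (1 + 1 / real n) ^ n"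
      using n by (simp add: field_simps add_pos_nonneg)
    also have "1 / (1 + 1 / real n) ^ n = (1 - 1 / real R) ^ n"
    proof -
      have "1 - 1 / real R = 1 / (1 + 1 / real n)" using n by (simp add: field_simps)
      then show ?thesis by (simp add: power_one_over)
    qed
    finally show ?thesis by (simp add: n_def)
  qed simp
  also have "\<dots> \<le> (1 - x) ^ (R - 1)"
    using assms by (intro power_mono) auto
  finally have "1 / 3 \<le> (1 - x) ^ (R - 1)" .
  moreover have "1 / 2 \<le> real R * x"
    using assms by (simp add: field_simps)
  ultimately have "(1 / 2) * (1 / 3) \<le> (real R * x) * (1 - x) ^ (R - 1)"
    by (intro mult_mono) auto
  then show ?thesis by simp
qed

text \<open>For finite nonempty \<open>A\<close> and \<open>R\<close> running through the powers of
  2, these dyadic shells cover all points of the interval where the sum is nonzero. Neighbouring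
  shells may share boundary points, which only increases the sum of their indicators.\<close>

definition energy_level :: "int set \<Rightarrow> real \<Rightarrow> nat \<Rightarrow> real set" where
  "energy_level A t R = {x \<in> {t..t + 1}. 1 / (2 * real R) \<le> (cmod (exp_sum A x) / card A)\<^sup>2
      \<and> (cmod (exp_sum A x) / card A)\<^sup>2 \<le> 1 / real R}"

lemma energy_level_sets [measurable]: "energy_level A t R \<in> sets (unit_interval_from t)"
proof -
  have "(\<lambda>x. (cmod (exp_sum A x) / card A)\<^sup>2) \<in> borel_measurable (unit_interval_from t)"
    by (intro borel_measurable_integrable integrable_unit_interval_from)
       (cases "card A = 0"; auto intro!: continuous_intros)
  then have [measurable]: "(\<lambda>x. (cmod (exp_sum A x) / card A)\<^sup>2) \<in> borel_measurable (unit_interval_from t)" .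
  have "energy_level A t R = {x \<in> space (unit_interval_from t). 1 / (2 * real R) \<le> (cmod (exp_sum A x) / card A)\<^sup>2
      \<and> (cmod (exp_sum A x) / card A)\<^sup>2 \<le> 1 / real R}"
    by (simp add: energy_level_def)
  also have "\<dots> \<in> sets (unit_interval_from t)" by measurable
  finally show ?thesis .
qed

lemma integral_ge_level:
  fixes F :: "real \<Rightarrow> real"
  assumes "continuous_on UNIV F" "\<And>x. F x \<ge> 0" "S \<in> sets (unit_interval_from t)" "\<And>x. x \<in> S \<Longrightarrow> c \<le> F x"
  shows "c * measure (unit_interval_from t) S \<le> (LINT x|unit_interval_from t. F x)"
proof -
  interpret finite_measure "unit_interval_from t" by (rule finite_measure_unit_interval_from)
  have "c * measure (unit_interval_from t) S = (LINT x|unit_interval_from t. c * indicator S x)"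
    using assms(3) sets.sets_into_space[OF assms(3)] by (simp add: Int_absorb1 Int_absorb2)
  also have "\<dots> \<le> (LINT x|unit_interval_from t. F x)"
  proof (rule integral_mono)
    show "integrable (unit_interval_from t) (\<lambda>x. c * indicator S x)"
      using assms(3) by (intro integrable_mult_right integrable_real_indicator) (auto simp: less_top[symmetric])
    show "c * indicator S x \<le> F x" for x
      using assms(2)[of x] assms(4)[of x] by (auto simp: indicator_def)
  qed (rule integrable_unit_interval_from[OF assms(1)])
  finally show ?thesis .
qed

text \<open>The polynomial \<open>R y (1 - y)^(R - 1)\<close> peaks at \<open>y = 1 / R\<close>; its \<open>k\<close>-th power is a smooth
  substitute for the indicator of the level set that is still a trigonometric polynomial.\<close>

lemma large_exp_sum_at_prime_dilate:
  fixes \<rho> :: real and D R k :: nat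
  assumes A: "finite A" "A \<noteq> {}" "\<And>a. a \<in> A \<Longrightarrow> 0 \<le> a \<and> a \<le> int D"
    and "D \<ge> 1" "R \<ge> 1" "k \<ge> 1"
    and P: "finite P" "P \<noteq> {}" "\<And>p. p \<in> P \<Longrightarrow> prime p"
    and \<rho>: "0 < \<rho>" "\<rho> \<le> measure (unit_interval_from t) (energy_level A t R)"
  obtains B where "B \<in> sets (unit_interval_from t)"
    and "measure (unit_interval_from t) B \<le> 4 * 6 ^ k * (1 + log 2 (real (k * R * D))) / (card P * \<rho>)"
    and "\<And>x. x \<in> {t..t + 1} - B \<Longrightarrow>
      \<exists>p\<in>P. (cmod (exp_sum A (real p * x)))\<^sup>2 \<ge> (real (card A))\<^sup>2 * \<rho> powr (1 / k) / (12 * R)"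
proof -
  define f where "f = (\<lambda>x. (cmod (exp_sum A x) / card A)\<^sup>2)"
  have N: "real (card A) > 0" using A by (simp add: card_gt_0_iff)
  have f01: "0 \<le> f x \<and> f x \<le> 1" for x
    using norm_exp_sum_le[of A x] N by (auto simp: f_def intro!: power_le_one)
  have contf: "continuous_on UNIV f"
    unfolding f_def using N by (intro continuous_intros) auto
  define u where "u = (\<lambda>x. real R * f x * (1 - f x) ^ (R - 1))"
  have u0: "0 \<le> u x" for x
    using f01[of x] by (simp add: u_def)
  have u1: "u x \<le> 1" for x
    using bump_le_1[of "f x" R] f01[of x] zero_le_power[of "1 - f x" R] unfolding u_def by linarith
  \<comment> \<open>This linear majorant converts a large value of the bump back into a large
    exponential sum.\<close>
  have uR: "u x \<le> R * f x" for x
    using f01[of x] by (simp add: u_def mult_left_le power_le_one)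
  \<comment> \<open>Averaging only yields a dilate where the function exceeds half of a lower bound
    for its mean, and that bound is proportional to \<open>\<rho>\<close>. Taking the k-th root
    afterwards reduces the loss to \<open>\<rho> powr (1 / k)\<close>, at the cost of a factor 6^k
    in the exceptional measure.\<close>
  define g where "g = (\<lambda>x. u x ^ k)"
  have contg: "continuous_on UNIV g"
    unfolding g_def u_def by (intro continuous_intros contf)
  have tf: "trig_poly D (\<lambda>x. complex_of_real (f x))"
    using trig_poly_mult[OF trig_poly_const[of 0 "complex_of_real (1 / (card A)\<^sup>2)"] trig_poly_norm_exp_sum_sq[OF A(1) A(3)]]
    by (simp add: f_def power_divide)
  have "trig_poly D (\<lambda>x. complex_of_real (1 - f x))"
    using trig_poly_add[OF trig_poly_const[of D 1] trig_poly_mult[OF trig_poly_const[of 0 "- 1"] tf, simplified]]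
    by simp
  from trig_poly_mult[OF trig_poly_const[of 0 "of_nat R"] trig_poly_mult[OF tf trig_poly_power[OF this, of "R - 1"]]]
  have "trig_poly (D + (R - 1) * D) (\<lambda>x. complex_of_real (u x))"
    by (simp add: u_def mult.assoc)
  moreover have "D + (R - 1) * D = R * D" using \<open>R \<ge> 1\<close> by (cases R) auto
  ultimately have tg: "trig_poly (k * R * D) (\<lambda>x. complex_of_real (g x))"
    using trig_poly_power[of "R * D" "\<lambda>x. complex_of_real (u x)" k] by (simp add: g_def mult.assoc)
  have "(1 / 6) ^ k * measure (unit_interval_from t) (energy_level A t R) \<le> (LINT x|unit_interval_from t. g x)"
  proof (rule integral_ge_level[OF contg])
    fix x assume "x \<in> energy_level A t R"
    then have "1 / 6 \<le> u x"
      using bump_lower[OF \<open>R \<ge> 1\<close>, of "f x"] by (simp add: energy_level_def f_def u_def)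
    then show "(1 / 6) ^ k \<le> g x" unfolding g_def by (intro power_mono) auto
  qed (auto simp: g_def u0)
  moreover have "(1 / 6) ^ k * \<rho> \<le> (1 / 6) ^ k * measure (unit_interval_from t) (energy_level A t R)"
    using \<rho> by (intro mult_left_mono) auto
  ultimately have mu: "(1 / 6) ^ k * \<rho> \<le> (LINT x|unit_interval_from t. g x)" by linarith
  have D': "k * R * D \<ge> 1" using assms(4-6) by (metis nat_mult_1 mult_le_mono)
  have g01: "0 \<le> g x \<and> g x \<le> 1" for x using u0 u1 by (auto simp: g_def intro!: power_le_one)
  obtain B where B: "B \<in> sets (unit_interval_from t)"
    "measure (unit_interval_from t) B \<le> 4 * (1 + log 2 (real (k * R * D))) / (card P * ((1 / 6) ^ k * \<rho>))"
    "\<And>x. x \<in> {t..t + 1} - B \<Longrightarrow> \<exists>p\<in>P. g (real p * x) > (1 / 6) ^ k * \<rho> / 2"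
    using prime_dilates_hit[OF tg contg D' g01 P _ mu] \<rho>(1) by auto
  show thesis
  proof (rule that[OF B(1)])
    show "measure (unit_interval_from t) B \<le> 4 * 6 ^ k * (1 + log 2 (real (k * R * D))) / (card P * \<rho>)"
      using B(2) by (simp add: power_one_over field_simps)
    fix x assume "x \<in> {t..t + 1} - B"
    then obtain p where p: "p \<in> P" "g (real p * x) > (1 / 6) ^ k * \<rho> / 2" using B(3) by blast
    define y where "y = u (real p * x)"
    \<comment> \<open>The 12 is 6 times 2: the factor 1/2 lost in averaging is at least (1/2)^k, so
      it can be put under the k-th root.\<close>
    have "(\<rho> powr (1 / k) / 12) ^ k \<le> (1 / 6) ^ k * \<rho> / 2"
    proof -
      have "(\<rho> powr (1 / k)) ^ k = \<rho>"
        using \<rho>(1) \<open>k \<ge> 1\<close> by (simp add: powr_powr flip: powr_realpow)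
      moreover have "(1 / 12 :: real) ^ k \<le> (1 / 6) ^ k / 2"
      proof -
        have "(1 / 12 :: real) ^ k = (1 / 6) ^ k * (1 / 2) ^ k" by (simp flip: power_mult_distrib)
        also have "(1 / 2 :: real) ^ k \<le> (1 / 2) ^ 1" using \<open>k \<ge> 1\<close> by (intro power_decreasing) auto
        finally show ?thesis by simp
      qed
      then have "\<rho> * (1 / 12) ^ k \<le> \<rho> * ((1 / 6) ^ k / 2)" using \<rho>(1) by (intro mult_left_mono) auto
      ultimately show ?thesis by (simp add: power_divide mult.commute)
    qed
    also have "\<dots> \<le> y ^ k" using p by (simp add: g_def y_def)
    finally have "\<rho> powr (1 / k) / 12 \<le> y"
      using power_mono_iff[of "\<rho> powr (1 / k) / 12" y k] u0 \<open>k \<ge> 1\<close> by (simp add: y_def)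
    also have "\<dots> \<le> R * f (real p * x)" unfolding y_def by (rule uR)
    also have "\<dots> = R * (cmod (exp_sum A (real p * x)))\<^sup>2 / (real (card A))\<^sup>2"
      by (simp add: f_def power_divide)
    finally have "(real (card A))\<^sup>2 * \<rho> powr (1 / k) / (12 * R) \<le> (cmod (exp_sum A (real p * x)))\<^sup>2"
      using N \<open>R \<ge> 1\<close> by (simp add: field_simps)
    then show "\<exists>p\<in>P. (cmod (exp_sum A (real p * x)))\<^sup>2 \<ge> (real (card A))\<^sup>2 * \<rho> powr (1 / k) / (12 * R)"
      using p(1) by blast
  qed
qed

text \<open>By the second moment, |S|^2 / N^2 has mean 1/N. Its values below 2^-(J+1) <= 1/(2N)
  account for at most half of this, so one of the \<open>J + 1\<close> dyadic shells carries at
  least 1/(2N(J+1)). Restricting the fourth moment to that shell then bounds 2^i from below in terms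
  of the energy.\<close>

lemma exists_large_energy_level:
  assumes A: "finite A" "A \<noteq> {}" and J: "card A \<le> 2 ^ J"
  obtains i where "i \<le> J" "measure (unit_interval_from t) (energy_level A t (2 ^ i)) \<ge> 2 ^ i / (2 * real (card A) * (real J + 1))"
    "real (card A) ^ 3 \<le> 8 * (real J + 1) * 2 ^ i * additive_energy A"
proof -
  let ?M = "unit_interval_from t"
  interpret finite_measure ?M by (rule finite_measure_unit_interval_from)
  define N where "N = real (card A)"
  define f where "f = (\<lambda>x. (cmod (exp_sum A x) / N)\<^sup>2)"
  have N: "N > 0" using A by (simp add: N_def card_gt_0_iff)
  have f01: "0 \<le> f x \<and> f x \<le> 1" for x
    using norm_exp_sum_le[of A x] N by (auto simp: f_def N_def intro!: power_le_one)
  have contf: "continuous_on UNIV f"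
    unfolding f_def using N by (intro continuous_intros) auto
  define w where "w = (\<lambda>i. measure ?M (energy_level A t (2 ^ i)))"
  have int_ind: "integrable ?M (\<lambda>x. (1 / 2 ^ i) * indicator (energy_level A t (2 ^ i)) x :: real)" for i
    by (intro integrable_mult_right integrable_real_indicator) (auto simp: less_top[symmetric])
  have "1 / N = (LINT x|?M. f x)"
    using exp_sum_second_moment[OF A(1), of t] N
    by (simp add: f_def power_divide N_def power2_eq_square)
  also have "\<dots> \<le> (LINT x|?M. (\<Sum>i\<le>J. (1 / 2 ^ i) * indicator (energy_level A t (2 ^ i)) x) + 1 / 2 ^ (J + 1))"
  proof (rule integral_mono)
    show "integrable ?M f" by (rule integrable_unit_interval_from[OF contf])
    show "integrable ?M (\<lambda>x. (\<Sum>i\<le>J. (1 / 2 ^ i) * indicat_real (energy_level A t (2 ^ i)) x) + 1 / 2 ^ (J + 1))"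
      by (intro Bochner_Integration.integrable_add Bochner_Integration.integrable_sum int_ind integrable_const)
    fix x assume x: "x \<in> space ?M"
    show "f x \<le> (\<Sum>i\<le>J. (1 / 2 ^ i) * indicator (energy_level A t (2 ^ i)) x) + 1 / 2 ^ (J + 1)"
    proof (cases "f x \<le> 1 / 2 ^ (J + 1)")
      case True
      then show ?thesis by (simp add: add_increasing sum_nonneg)
    next
      case False
      \<comment> \<open>Minimality puts \<open>x\<close> into shell \<open>i\<close>: the lower
        bound holds at \<open>i\<close> and fails just before, while for \<open>i = 0\<close> the
        upper bound is f x <= 1.\<close>
      define i where "i = (LEAST j. f x > 1 / 2 ^ (j + 1))"
      have i1: "f x > 1 / 2 ^ (i + 1)" unfolding i_def by (rule LeastI[of _ J]) (use False in simp)
      have i2: "i \<le> J" unfolding i_def by (rule Least_le) (use False in simp)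
      have i3: "f x \<le> 1 / 2 ^ i"
      proof (cases i)
        case 0
        then show ?thesis using f01[of x] by simp
      next
        case (Suc j)
        then have "\<not> f x > 1 / 2 ^ (j + 1)" using not_less_Least[of j "\<lambda>j. f x > 1 / 2 ^ (j + 1)"] unfolding i_def by auto
        then show ?thesis using Suc by simp
      qed
      have "x \<in> energy_level A t (2 ^ i)"
        using i1 i3 x by (simp add: energy_level_def f_def N_def)
      then have "f x \<le> (1 / 2 ^ i) * indicator (energy_level A t (2 ^ i)) x" using i3 by simp
      also have "\<dots> \<le> (\<Sum>i\<le>J. (1 / 2 ^ i) * indicator (energy_level A t (2 ^ i)) x)"
        using i2 by (intro member_le_sum) auto
      finally show ?thesis by (simp add: add_increasing2)
    qed
  qed
  also have "\<dots> = (\<Sum>i\<le>J. w i / 2 ^ i) + 1 / 2 ^ (J + 1)"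
  proof -
    have "(LINT x|?M. (1 / 2 ^ i) * indicator (energy_level A t (2 ^ i)) x) = w i / 2 ^ i" for i
      using sets.sets_into_space[OF energy_level_sets[of A t "2 ^ i"]] by (simp add: w_def Int_absorb1 Int_absorb2)
    moreover have "measure ?M (space ?M) = 1" using measure_unit_interval_from[of t] by simp
    ultimately show ?thesis
      by (subst Bochner_Integration.integral_add Bochner_Integration.integral_sum;
          (intro Bochner_Integration.integrable_sum int_ind integrable_const)?)+ simp
  qed
  also have "1 / 2 ^ (J + 1) \<le> 1 / (2 * N)"
  proof -
    have "N \<le> 2 ^ J" using J unfolding N_def by (metis of_nat_le_iff of_nat_numeral of_nat_power)
    then show ?thesis using N by (simp add: field_simps)
  qed
  finally have sum: "1 / (2 * N) \<le> (\<Sum>i\<le>J. w i / 2 ^ i)" using N by (simp add: field_simps)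
  have "\<exists>i\<le>J. w i / 2 ^ i \<ge> 1 / (2 * N * (J + 1))"
  proof (rule ccontr)
    assume "\<not> ?thesis"
    then have "w i / 2 ^ i < 1 / (2 * N * (J + 1))" if "i \<le> J" for i
      using that by (meson not_le_imp_less)
    then have "(\<Sum>i\<le>J. w i / 2 ^ i) < (\<Sum>i\<le>J. 1 / (2 * N * (J + 1)))"
      by (intro sum_strict_mono) auto
    also have "\<dots> = real (J + 1) * (1 / (2 * N * real (J + 1)))" by simp
    also have "\<dots> = 1 / (2 * N)" by (simp del: of_nat_add of_nat_Suc)
    finally show False using sum by simp
  qed
  then obtain i where i: "i \<le> J" "w i / 2 ^ i \<ge> 1 / (2 * N * (J + 1))" by blast
  then have w: "w i \<ge> 2 ^ i / (2 * N * (J + 1))" by (simp add: field_simps)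
  have "(1 / (2 * 2 ^ i))\<^sup>2 * w i \<le> (LINT x|?M. (f x)\<^sup>2)"
    unfolding w_def
  proof (rule integral_ge_level)
    fix x assume "x \<in> energy_level A t (2 ^ i)"
    then show "(1 / (2 * 2 ^ i))\<^sup>2 \<le> (f x)\<^sup>2"
      by (intro power_mono) (auto simp: energy_level_def f_def N_def)
  qed (auto intro!: continuous_intros contf)
  also have "\<dots> = additive_energy A / N ^ 4"
    using exp_sum_fourth_moment[OF A(1), of t] by (simp add: f_def power_divide N_def flip: power_mult)
  finally have "(1 / (2 * 2 ^ i))\<^sup>2 * (2 ^ i / (2 * N * (J + 1))) \<le> additive_energy A / N ^ 4"
    using w by (meson mult_left_mono order_trans zero_le_power2)
  moreover define l where "l = real (J + 1)"
  ultimately have "(1 / (2 * 2 ^ i))\<^sup>2 * (2 ^ i / (2 * N * l)) \<le> additive_energy A / N ^ 4" "l > 0"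
    by simp_all
  then have "N ^ 3 \<le> 8 * l * 2 ^ i * additive_energy A"
    using N by (simp add: field_simps power2_eq_square power3_eq_cube power4_eq_xxxx)
  then have "N ^ 3 \<le> 8 * (real J + 1) * 2 ^ i * additive_energy A"
    by (simp add: l_def add.commute)
  then show thesis using that[OF i(1)] w by (simp add: w_def N_def add.commute)
qed

section \<open>Discrepancy\<close>

text \<open>At \<open>\<beta> = 1\<close> this also yields that the discrepancy is
  nonnegative.\<close>

lemma star_discrepancy_upper:
  assumes "0 < \<beta>" "\<beta> \<le> 1"
  shows "\<bar>real (card {n \<in> {1..N}. x n \<in> {0..<\<beta>}}) / real N - \<beta>\<bar> \<le> star_discrepancy N x"
  unfolding star_discrepancy_def
proof (rule cSUP_upper)
  show "bdd_above ((\<lambda>\<beta>. \<bar>real (card {n \<in> {1..N}. x n \<in> {0..<\<beta>}}) / real N - \<beta>\<bar>) ` {0<..1})"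
  proof (rule bdd_aboveI2)
    fix b :: real assume b: "b \<in> {0<..1}"
    have "card {n \<in> {1..N}. x n \<in> {0..<b}} \<le> card {1..N}"
      by (intro card_mono) auto
    then have "real (card {n \<in> {1..N}. x n \<in> {0..<b}}) / real N \<le> 1"
      by (cases "N = 0") auto
    moreover have "real (card {n \<in> {1..N}. x n \<in> {0..<b}}) / real N \<ge> 0" by simp
    ultimately show "\<bar>real (card {n \<in> {1..N}. x n \<in> {0..<b}}) / real N - b\<bar> \<le> 2"
      using b unfolding abs_le_iff greaterThanAtMost_iff by linarith
  qed
qed (use assms in auto)

text \<open>Partial summation: \<open>\<Sum>n. e(h x\<^sub>n) = - \<integral>\<^sub>0\<^sup>1 (A\<^sub>N(\<beta>) - N \<beta>) d e(h \<beta>)\<close>.\<close>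

lemma norm_unit_exp_sum_le_star_discrepancy:
  fixes x :: "nat \<Rightarrow> real" and h N :: nat
  assumes x: "\<And>n. n \<in> {1..N} \<Longrightarrow> 0 \<le> x n \<and> x n < 1" and "h \<ge> 1" "N \<ge> 1"
  shows "cmod (\<Sum>n\<in>{1..N}. unit_exp (real h * x n)) \<le> 2 * pi * real h * (real N * star_discrepancy N x)"
proof -
  define K where "K = complex_of_real (2 * pi * real h) * \<i>"
  have K0: "K \<noteq> 0" using \<open>h \<ge> 1\<close> by (simp add: K_def)
  define e where "e = (\<lambda>b. unit_exp (real h * b))"
  have e_deriv: "(e has_vector_derivative K * e b) (at b within S)" for b S
    using has_vector_derivative_unit_exp[of "real h" b S] by (simp add: e_def K_def)
  have e1: "e 1 = 1" and e0: "e 0 = 1"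
    using unit_exp_int[of "int h"] by (auto simp: e_def)
  \<comment> \<open>A sample point \<open>y\<close> contributes the integral of the derivative of
    \<open>e\<close> from \<open>y\<close> to 1. As \<open>h\<close> is an integer,
    \<open>e 1 = 1\<close>. The closed interval and the strict inequality differ only at
    \<open>y\<close>.\<close>
  have step: "((\<lambda>b. K * e b * of_bool (y < b)) has_integral (1 - e y)) {0..1}" if "0 \<le> y" "y < 1" for y
  proof -
    have "((\<lambda>b. K * e b) has_integral (e 1 - e y)) {y..1}"
      using that by (intro fundamental_theorem_of_calculus e_deriv) auto
    then have "((\<lambda>b. if b \<in> {y..1} then K * e b else 0) has_integral (e 1 - e y)) {0..1}"
      using that by (subst has_integral_restrict) auto
    then show ?thesis unfolding e1
      by (rule has_integral_spike_finite[of "{y}", rotated 2]) auto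
  qed
  have linear: "((\<lambda>b. K * e b * of_real b) has_integral 1) {0..1}"
  proof -
    have "((\<lambda>b. K * e b * of_real b) has_integral
        ((of_real 1 * e 1 - e 1 / K) - (of_real 0 * e 0 - e 0 / K))) {0..1}"
    proof (rule fundamental_theorem_of_calculus)
      fix b :: real
      have id: "(complex_of_real has_vector_derivative 1) (at b within {0..1})"
        using has_vector_derivative_of_real[OF DERIV_ident, of "at b within {0..1}"] by simp
      have div: "((\<lambda>b. e b / K) has_vector_derivative e b) (at b within {0..1})"
        using bounded_linear.has_vector_derivative[OF bounded_linear_mult_left[of "1 / K"] e_deriv[of b "{0..1}"]] K0
        by (simp add: field_simps)
      show "((\<lambda>b. of_real b * e b - e b / K) has_vector_derivative K * e b * of_real b) (at b within {0..1})"
        using has_vector_derivative_diff[OF has_vector_derivative_mult[OF id e_deriv[of b "{0..1}"]] div]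
        by (simp add: mult_ac)
    qed simp
    then show ?thesis by (simp add: e1 e0)
  qed
  define A where "A = (\<lambda>b. (\<Sum>n\<in>{1..N}. of_bool (x n < b)) :: real)"
  have A_card: "A b = card {n \<in> {1..N}. x n \<in> {0..<b}}" for b
  proof -
    have "{n \<in> {1..N}. x n \<in> {0..<b}} = {n \<in> {1..N}. x n < b}" using x by auto
    then show ?thesis by (simp add: A_def sum_of_bool_eq Int_def)
  qed
  \<comment> \<open>The \<open>N\<close> ones coming from the sample points cancel against the
    linear part, which leaves minus the exponential sum.\<close>
  have "((\<lambda>b. (\<Sum>n\<in>{1..N}. K * e b * of_bool (x n < b)) - of_nat N * (K * e b * of_real b))
      has_integral ((\<Sum>n\<in>{1..N}. 1 - e (x n)) - of_nat N * 1)) {0..1}"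
    by (intro has_integral_diff has_integral_sum has_integral_mult_right step linear) (use x in auto)
  moreover have "(\<Sum>n\<in>{1..N}. K * e b * of_bool (x n < b)) - of_nat N * (K * e b * of_real b)
      = K * e b * of_real (A b - real N * b)" for b
    by (simp add: A_def sum_distrib_left algebra_simps of_bool_def if_distrib cong: if_cong)
  moreover have "(\<Sum>n\<in>{1..N}. 1 - e (x n)) - of_nat N * 1 = - (\<Sum>n\<in>{1..N}. e (x n))"
    by (simp add: sum_subtractf)
  ultimately have I: "((\<lambda>b. K * e b * of_real (A b - real N * b)) has_integral - (\<Sum>n\<in>{1..N}. e (x n))) {0..1}"
    by simp
  have D0: "star_discrepancy N x \<ge> 0"
    using star_discrepancy_upper[of 1 N x] by linarith
  \<comment> \<open>The supremum leaves out \<open>\<beta> = 0\<close>, but there both the count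
    over the empty interval and the linear term vanish.\<close>
  have bound: "\<bar>A b - real N * b\<bar> \<le> real N * star_discrepancy N x" if "b \<in> {0..1}" for b
  proof (cases "b = 0")
    case True
    then show ?thesis using D0 by (simp add: A_card)
  next
    case False
    have "\<bar>A b - real N * b\<bar> = real N * \<bar>A b / real N - b\<bar>"
      using \<open>N \<ge> 1\<close> abs_mult[of "real N" "A b / real N - b"] by (simp add: right_diff_distrib)
    also have "\<dots> \<le> real N * star_discrepancy N x"
      using star_discrepancy_upper[of b N x] that False unfolding A_card by (intro mult_left_mono) auto
    finally show ?thesis .
  qed
  have "cmod (- (\<Sum>n\<in>{1..N}. e (x n))) \<le> (2 * pi * real h * (real N * star_discrepancy N x)) * measure lborel {0..1::real}"
  proof (rule has_integral_bound_real[OF _ finite.emptyI I])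
    show "cmod (K * e b * of_real (A b - real N * b)) \<le> 2 * pi * real h * (real N * star_discrepancy N x)"
      if "b \<in> {0..1} - {}" for b
      using that bound by (auto simp: norm_mult K_def e_def intro!: mult_left_mono simp del: of_real_diff)
  qed (use D0 in auto)
  then show ?thesis by (simp add: e_def)
qed

text \<open>Multiplying by an integer \<open>q\<close> keeps integer parts integral, so each
  \<open>a n * x\<close> may be replaced by its fractional part inside the exponential.\<close>

lemma norm_exp_sum_dilate_le_star_discrepancy:
  fixes a :: "nat \<Rightarrow> int" and q N :: nat
  assumes "inj_on a {1..N}" and "q \<ge> 1" "N \<ge> 1"
  shows "cmod (exp_sum (a ` {1..N}) (real q * x))
    \<le> 2 * pi * real q * (real N * star_discrepancy N (\<lambda>n. frac (real_of_int (a n) * x)))"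
proof -
  have *: "unit_exp (of_int (a n) * (real q * x)) = unit_exp (real q * frac (real_of_int (a n) * x))" for n
  proof -
    have "of_int (a n) * (real q * x)
        = real q * frac (real_of_int (a n) * x) + of_int (int q * \<lfloor>real_of_int (a n) * x\<rfloor>)"
      by (simp add: frac_def algebra_simps)
    then show ?thesis by (simp only: unit_exp_add unit_exp_int mult_1_right)
  qed
  have "exp_sum (a ` {1..N}) (real q * x) = (\<Sum>n\<in>{1..N}. unit_exp (real q * frac (real_of_int (a n) * x)))"
    unfolding exp_sum_def by (subst sum.reindex[OF assms(1)]) (simp add: *)
  then show ?thesis
    using norm_unit_exp_sum_le_star_discrepancy[of N "\<lambda>n. frac (real_of_int (a n) * x)" q] assms
    by (simp add: frac_lt_1)
qed

section \<open>Large discrepancy outside an exceptional set\<close>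

text \<open>Primes up to about N^\<eta> / \<rho> are numerous enough to make the exceptional measure
  N^(-\<eta>) up to logarithms. Dividing by such a prime costs N^(2\<eta>) in the square, and the
  factor \<rho>^(1/k) costs another N^\<eta> because \<rho> >= N^(-2) and 2/k <= \<eta>; together
  they give the 3\<eta>.\<close>

lemma large_discrepancy_off_small_set:
  fixes a :: "nat \<Rightarrow> int" and N D J k :: nat and C \<kappa> \<eta> t :: real
  assumes inj: "inj_on a {1..N}" and a: "\<And>n. n \<in> {1..N} \<Longrightarrow> 0 \<le> a n \<and> a n \<le> int D" and "D \<ge> 1"
    and E: "real (additive_energy (a ` {1..N})) \<le> C * real N powr \<kappa>" and "C > 0"
    and J: "N \<le> 2 ^ J" "2 ^ J \<le> 2 * N" "2 * (J + 1) \<le> N"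
    and k: "k \<ge> 1" "2 / real k \<le> \<eta>" and \<eta>: "\<eta> \<le> 1" "real N powr \<eta> \<ge> 4"
  obtains B where "B \<in> sets (unit_interval_from t)"
    and "measure (unit_interval_from t) B
      \<le> 64 * 6 ^ k * (1 + log 2 (real (k * (2 * N) * D))) * ln (real N) / real N powr \<eta>"
    and "\<And>x. x \<in> {t..t + 1} - B \<Longrightarrow>
      (real N * star_discrepancy N (\<lambda>n. frac (real_of_int (a n) * x)))\<^sup>2
        \<ge> real N powr (3 - \<kappa> - 3 * \<eta>) / (6144 * pi\<^sup>2 * C * (real J + 1) ^ 3)"
proof -
  define A where "A = a ` {1..N}"
  have cardA: "card A = N" using inj by (simp add: A_def card_image)
  have N: "N \<ge> 2" using J(3) by simp
  have A: "finite A" "A \<noteq> {}" using N by (auto simp: A_def)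
  have \<eta>0: "\<eta> > 0" using k by (meson divide_pos_pos less_le_trans of_nat_0_less_iff zero_less_numeral less_le_trans zero_less_one)
  obtain i where i: "i \<le> J"
      "measure (unit_interval_from t) (energy_level A t (2 ^ i)) \<ge> 2 ^ i / (2 * real (card A) * (real J + 1))"
      "real (card A) ^ 3 \<le> 8 * (real J + 1) * 2 ^ i * additive_energy A"
    using exists_large_energy_level[OF A, of J t] J(1) cardA by auto
  define R where "R = (2::nat) ^ i"
  have R: "R \<ge> 1" "R \<le> 2 * N"
    using order_trans[OF power_increasing[OF i(1), of "2::nat"] J(2)] by (auto simp: R_def)
  define l where "l = real J + 1"
  have l: "l \<ge> 1" "2 * l \<le> N" using J(3) by (auto simp: l_def)
  \<comment> \<open>This is the guaranteed measure of the level, not its exact measure, and so an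
    explicit multiple of \<open>R\<close>.\<close>
  define \<rho> where "\<rho> = real R / (2 * real N * l)"
  have \<rho>: "\<rho> > 0" "\<rho> \<le> measure (unit_interval_from t) (energy_level A t R)"
    using N R l i(2) by (auto simp: \<rho>_def R_def cardA l_def add_ac)
  have \<rho>1: "\<rho> \<le> 1"
  proof -
    have "real R \<le> 2 * real N * 1" using R by linarith
    also have "\<dots> \<le> 2 * real N * l" using l by (intro mult_left_mono) auto
    finally show ?thesis using N l by (simp add: \<rho>_def)
  qed
  have \<rho>N: "real N powr - 2 \<le> \<rho>"
  proof -
    have "real N * (2 * l) \<le> real N * real N" using l by (intro mult_left_mono) auto
    also have "\<dots> \<le> real R * (real N * real N)" using R by (simp add: mult_le_cancel_right1)
    finally have "1 / (real N * real N) \<le> \<rho>" using N l by (simp add: \<rho>_def field_simps)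
    then show ?thesis using N by (simp add: powr_minus power2_eq_square divide_inverse)
  qed
  define H where "H = nat \<lceil>real N powr \<eta> / \<rho>\<rceil>"
  have H_low: "real N powr \<eta> / \<rho> \<le> real H" unfolding H_def by (rule real_nat_ceiling_ge)
  have ge4: "real N powr \<eta> / \<rho> \<ge> 4"
    using \<rho> \<rho>1 \<eta>(2) by (simp add: field_simps) 
  then have H4: "H \<ge> 4" using H_low by linarith
  have H_up: "real H \<le> 2 * (real N powr \<eta> / \<rho>)"
    using ge4 unfolding H_def by linarith
  have H_N: "real H \<le> real N ^ 4"
  proof -
    have "1 / \<rho> \<le> real N ^ 2"
      using \<rho>N \<rho>(1) N by (simp add: powr_minus field_simps)
    moreover have "real N powr \<eta> \<le> real N"
      using powr_mono[of \<eta> 1 "real N"] \<eta> N by simp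
    ultimately have "real N powr \<eta> * (1 / \<rho>) \<le> real N * real N ^ 2"
      using \<rho>(1) by (intro mult_mono) auto
    then have "2 * (real N powr \<eta> / \<rho>) \<le> real N * (real N * real N ^ 2)"
      using N ge4 by (intro mult_mono) auto
    then show ?thesis using H_up by (simp add: power2_eq_square power4_eq_xxxx mult.assoc)
  qed
  define P where "P = {p. prime p \<and> p \<le> H}"
  have "finite P" by (simp add: P_def)
  have "2 \<in> P" using H4 by (simp add: P_def)
  have lnN: "ln (real N) > 0" using N by simp
  \<comment> \<open>The 16 is 4 times 4: one factor comes from the prime count, the other from ln H
    <= 4 ln N.\<close>
  have cardP: "real (card P) * \<rho> \<ge> real N powr \<eta> / (16 * ln (real N))"
  proof -
    have lnH: "ln (real H) \<le> 4 * ln (real N)" "ln (real H) > 0"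
    proof -
      have "ln (real H) \<le> ln (real N ^ 4)" using H_N H4 N by (subst ln_le_cancel_iff) auto
      also have "\<dots> = 4 * ln (real N)" using N by (simp add: ln_realpow)
      finally show "ln (real H) \<le> 4 * ln (real N)" .
    qed (use H4 in auto)
    have "real N powr \<eta> / \<rho> / (16 * ln (real N)) \<le> real H / (4 * ln (real H))"
      using H_low lnH \<rho>(1) by (intro frac_le) auto
    also have "\<dots> \<le> card P" unfolding P_def by (rule prime_count_lower_bound[OF H4])
    finally have "real N powr \<eta> / \<rho> / (16 * ln (real N)) * \<rho> \<le> card P * \<rho>"
      using \<rho>(1) by (intro mult_right_mono) auto
    then show ?thesis using \<rho>(1) by simp
  qed
  obtain B where B: "B \<in> sets (unit_interval_from t)"
    "measure (unit_interval_from t) B \<le> 4 * 6 ^ k * (1 + log 2 (real (k * R * D))) / (card P * \<rho>)"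
    "\<And>x. x \<in> {t..t + 1} - B \<Longrightarrow>
      \<exists>p\<in>P. (cmod (exp_sum A (real p * x)))\<^sup>2 \<ge> (real (card A))\<^sup>2 * \<rho> powr (1 / k) / (12 * R)"
  proof (rule large_exp_sum_at_prime_dilate[OF A _ \<open>D \<ge> 1\<close> R(1) k(1) \<open>finite P\<close> _ _ \<rho>])
    show "0 \<le> z \<and> z \<le> int D" if "z \<in> A" for z using that a by (auto simp: A_def)
    show "P \<noteq> {}" using \<open>2 \<in> P\<close> by auto
    show "prime p" if "p \<in> P" for p using that by (simp add: P_def)
  qed (use that in blast)
  show thesis
  proof (rule that[OF B(1)])
    have "k * R * D \<ge> 1" using k(1) R(1) \<open>D \<ge> 1\<close> by (metis nat_mult_1 mult_le_mono)
    moreover have "k * R * D \<le> k * (2 * N) * D" using R(2) by (intro mult_le_mono) auto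
    ultimately have log: "log 2 (real (k * R * D)) \<le> log 2 (real (k * (2 * N) * D))" "0 \<le> log 2 (real (k * R * D))"
      by (auto simp del: of_nat_mult) 
    note B(2)
    also have "4 * 6 ^ k * (1 + log 2 (real (k * R * D))) / (card P * \<rho>)
        \<le> 4 * 6 ^ k * (1 + log 2 (real (k * (2 * N) * D))) / (real N powr \<eta> / (16 * ln (real N)))"
      using log cardP lnN N by (intro frac_le mult_left_mono) (auto intro!: mult_nonneg_nonneg simp del: of_nat_mult)
    also have "\<dots> = 64 * 6 ^ k * (1 + log 2 (real (k * (2 * N) * D))) * ln (real N) / real N powr \<eta>"
      by simp
    finally show "measure (unit_interval_from t) B
      \<le> 64 * 6 ^ k * (1 + log 2 (real (k * (2 * N) * D))) * ln (real N) / real N powr \<eta>" .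
  next
    fix x assume "x \<in> {t..t + 1} - B"
    then obtain p where p: "p \<in> P"
      "(cmod (exp_sum A (real p * x)))\<^sup>2 \<ge> (real N)\<^sup>2 * \<rho> powr (1 / k) / (12 * R)"
      using B(3) cardA by blast
    define S where "S = real N * star_discrepancy N (\<lambda>n. frac (real_of_int (a n) * x))"
    have "star_discrepancy N (\<lambda>n. frac (real_of_int (a n) * x)) \<ge> 0"
      using star_discrepancy_upper[of 1 N "\<lambda>n. frac (real_of_int (a n) * x)"] by linarith
    then have S0: "S \<ge> 0" by (simp add: S_def)
    have p1: "p \<ge> 1" "p \<le> H" using p(1) prime_ge_1_nat by (auto simp: P_def)
    have "cmod (exp_sum A (real p * x)) \<le> 2 * pi * real p * S"
      using norm_exp_sum_dilate_le_star_discrepancy[OF inj p1(1)] N by (simp add: A_def S_def)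
    also have "\<dots> \<le> 2 * pi * (2 * (real N powr \<eta> / \<rho>)) * S"
      using p1(2) H_up S0 by (intro mult_right_mono mult_left_mono) auto
    finally have "(cmod (exp_sum A (real p * x)))\<^sup>2 \<le> (2 * pi * (2 * (real N powr \<eta> / \<rho>)) * S)\<^sup>2"
      by (intro power_mono) auto
    with p(2) have "(real N)\<^sup>2 * \<rho> powr (1 / k) / (12 * R) \<le> (2 * pi * (2 * (real N powr \<eta> / \<rho>)) * S)\<^sup>2"
      by linarith
    also have "\<dots> = 16 * pi\<^sup>2 * (real N powr \<eta>)\<^sup>2 / \<rho>\<^sup>2 * S\<^sup>2"
      by (simp add: power_mult_distrib power_divide)
    finally have S1: "(real N)\<^sup>2 * \<rho>\<^sup>2 * \<rho> powr (1 / k) / (192 * R * pi\<^sup>2 * (real N powr \<eta>)\<^sup>2) \<le> S\<^sup>2"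
      using \<rho>(1) R(1) N by (simp add: field_simps)
    have "(real N)\<^sup>2 * \<rho>\<^sup>2 * \<rho> powr (1 / k) / (192 * R * pi\<^sup>2 * (real N powr \<eta>)\<^sup>2)
        = (real N)\<^sup>2 * \<rho>\<^sup>2 / (192 * R * pi\<^sup>2) * (\<rho> powr (1 / k) / (real N powr \<eta>)\<^sup>2)"
      by simp
    \<comment> \<open>Since \<rho> is R / (2 N l), the main term N^2 \<rho>^2 / R is
      \<open>R\<close> itself up to a constant and \<open>l\<close> squared. The energy then enters
      through the lower bound for \<open>R\<close>.\<close>
    also have "(real N)\<^sup>2 * \<rho>\<^sup>2 / (192 * R * pi\<^sup>2) = R / (768 * pi\<^sup>2 * l\<^sup>2)"
      using N R l by (simp add: \<rho>_def field_simps power2_eq_square)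
    finally have S2: "R / (768 * pi\<^sup>2 * l\<^sup>2) * (\<rho> powr (1 / k) / (real N powr \<eta>)\<^sup>2) \<le> S\<^sup>2"
      using S1 by simp
    have R_low: "R \<ge> real N powr (3 - \<kappa>) / (8 * C * l)"
    proof -
      have "real N ^ 3 \<le> 8 * l * R * additive_energy A"
        using i(3) by (simp add: cardA R_def l_def add_ac)
      also have "\<dots> \<le> 8 * l * R * (C * real N powr \<kappa>)"
        using E l unfolding A_def by (intro mult_left_mono) auto
      finally have "real N powr 3 \<le> 8 * l * R * (C * real N powr \<kappa>)"
        using N by simp
      then show ?thesis
        using N l \<open>C > 0\<close> by (simp add: powr_diff field_simps)
    qed
    have "real N powr - \<eta> \<le> \<rho> powr (1 / k)"
    proof -
      have "real N powr - \<eta> \<le> real N powr (- 2 * (1 / k))"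
        using k N by (intro powr_mono) auto
      also have "\<dots> = (real N powr - 2) powr (1 / k)" by (simp add: powr_powr)
      also have "\<dots> \<le> \<rho> powr (1 / k)" using \<rho>N by (intro powr_mono2) auto
      finally show ?thesis .
    qed
    moreover have "(real N powr \<eta>)\<^sup>2 = real N powr (2 * \<eta>)"
      using N by (simp add: power2_eq_square flip: powr_add)
    ultimately have "real N powr - \<eta> / real N powr (2 * \<eta>) \<le> \<rho> powr (1 / k) / (real N powr \<eta>)\<^sup>2"
      by (simp add: divide_right_mono)
    then have \<rho>_low: "real N powr (- 3 * \<eta>) \<le> \<rho> powr (1 / k) / (real N powr \<eta>)\<^sup>2"
      by (simp flip: powr_diff)
    \<comment> \<open>Here 6144 = 8 * 768, where the 8 comes from the bound for \<open>R\<close> and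
      768 = 12 * 16 * 4.\<close>
    have "real N powr (3 - \<kappa> - 3 * \<eta>) / (6144 * pi\<^sup>2 * C * l ^ 3)
       = real N powr (3 - \<kappa>) / (8 * C * l) / (768 * pi\<^sup>2 * l\<^sup>2) * real N powr (- 3 * \<eta>)"
      using N l \<open>C > 0\<close> powr_add[of "real N" "3 - \<kappa>" "- 3 * \<eta>"] by (simp add: power2_eq_square power3_eq_cube)
    also have "\<dots> \<le> R / (768 * pi\<^sup>2 * l\<^sup>2) * (\<rho> powr (1 / k) / (real N powr \<eta>)\<^sup>2)"
      using R_low \<rho>_low l by (intro mult_mono divide_right_mono) auto
    also note S2
    finally show "(real N * star_discrepancy N (\<lambda>n. frac (real_of_int (a n) * x)))\<^sup>2
        \<ge> real N powr (3 - \<kappa> - 3 * \<eta>) / (6144 * pi\<^sup>2 * C * (real J + 1) ^ 3)"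
      unfolding S_def l_def .
  qed
qed

text \<open>The largest frequency enters the exceptional measure only through its logarithm, of
  order (log N)^2, so that measure is at most a power of log N divided by N^\<eta> and tends to 0.
  Constants and the power of \<open>J\<close> are absorbed by one more N^\<eta>, and the square root
  turns 3\<eta> + \<eta> into 2\<eta>.\<close>

lemma eventually_large_discrepancy:
  fixes a :: "nat \<Rightarrow> int" and \<gamma> \<kappa> \<eta> t :: real
  assumes mono: "strict_mono_on {1..} a" and pos: "\<forall>n\<ge>1. a n > 0" and "\<gamma> > 0"
    and growth: "vinogradov_le (\<lambda>n. real_of_int (a n)) (\<lambda>n. exp (\<gamma> * (ln (real n))\<^sup>2))"
    and energy: "vinogradov_le (\<lambda>N. real (additive_energy (a ` {1..N}))) (\<lambda>N. real N powr \<kappa>)"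
    and \<eta>: "0 < \<eta>" "\<eta> \<le> 1"
  obtains b :: "nat \<Rightarrow> real" where "b \<longlonglongrightarrow> 0"
    and "eventually (\<lambda>N. \<exists>B\<in>sets (unit_interval_from t). measure (unit_interval_from t) B \<le> b N \<and>
      (\<forall>x\<in>{t..t + 1} - B. real N powr ((3 - \<kappa>) / 2 - 2 * \<eta>)
        \<le> real N * star_discrepancy N (\<lambda>n. frac (real_of_int (a n) * x)))) sequentially"
proof -
  obtain C0 where C0: "\<And>N. N \<ge> 1 \<Longrightarrow> real_of_int (a N) \<le> C0 * exp (\<gamma> * (ln (real N))\<^sup>2)"
    using growth unfolding vinogradov_le_def by blast
  obtain C1 where C1: "\<And>N. N \<ge> 1 \<Longrightarrow> real (additive_energy (a ` {1..N})) \<le> C1 * real N powr \<kappa>"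
    using energy unfolding vinogradov_le_def by blast
  define C where "C = max C1 1"
  have C: "C > 0" by (simp add: C_def)
  have E: "real (additive_energy (a ` {1..N})) \<le> C * real N powr \<kappa>" if "N \<ge> 1" for N
    using C1[OF that] mult_right_mono[of C1 C "real N powr \<kappa>"] by (simp add: C_def)
  have C0pos: "C0 > 0"
  proof -
    have "0 < real_of_int (a 1)" using pos by simp
    then show ?thesis using C0[of 1] by simp
  qed
  define k where "k = nat \<lceil>2 / \<eta>\<rceil> + 1"
  have k: "k \<ge> 1" by (simp add: k_def)
  have k2: "2 / real k \<le> \<eta>"
  proof -
    have "2 / \<eta> \<le> real k" unfolding k_def by linarith
    then show ?thesis using \<eta> k by (simp add: field_simps)
  qed
  define K where "K = real k"
  have K: "K > 0" using k by (simp add: K_def)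
  define b where "b = (\<lambda>N. 64 * 6 ^ k * (1 + log 2 (2 * K * C0 * real N * exp (\<gamma> * (ln (real N))\<^sup>2))) * ln (real N) / real N powr \<eta>)"
  have "(\<lambda>N. (1 + log 2 (2 * K * C0 * real N * exp (\<gamma> * (ln (real N))\<^sup>2))) * ln (real N) / real N powr \<eta>) \<longlonglongrightarrow> 0"
    using K C0pos \<open>\<gamma> > 0\<close> \<eta> by real_asymp
  from tendsto_mult_right_zero[OF this, of "64 * 6 ^ k"] have b0: "b \<longlonglongrightarrow> 0"
    unfolding b_def by (simp add: mult.assoc)
  have ev1: "eventually (\<lambda>N. real N powr \<eta> \<ge> 4) sequentially"
    using \<eta> by real_asymp
  have ev2: "eventually (\<lambda>N. 2 * (log 2 (2 * real N) + 2) \<le> real N) sequentially"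
    by real_asymp
  have ev3: "eventually (\<lambda>N. 6144 * pi\<^sup>2 * C * (log 2 (2 * real N) + 2) ^ 3 \<le> real N powr \<eta>) sequentially"
    using C \<eta> by real_asymp
  have "eventually (\<lambda>N. \<exists>B\<in>sets (unit_interval_from t). measure (unit_interval_from t) B \<le> b N \<and>
      (\<forall>x\<in>{t..t + 1} - B. real N powr ((3 - \<kappa>) / 2 - 2 * \<eta>)
        \<le> real N * star_discrepancy N (\<lambda>n. frac (real_of_int (a n) * x)))) sequentially"
    using ev1 ev2 ev3 eventually_ge_at_top[of 2]
  proof eventually_elim
    case (elim N)
    define J where "J = (LEAST j. N \<le> 2 ^ j)"
    have J1: "N \<le> 2 ^ J" unfolding J_def by (rule LeastI[of _ N]) (simp add: less_imp_le)
    have J2: "2 ^ J \<le> 2 * N"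
    proof (cases J)
      case (Suc j)
      then have "\<not> N \<le> 2 ^ j" using not_less_Least[of j "\<lambda>j. N \<le> 2 ^ j"] unfolding J_def by auto
      then show ?thesis using Suc by simp
    qed (use elim in auto)
    have J3: "real J \<le> log 2 (2 * real N)"
    proof -
      have "(2::real) ^ J \<le> 2 * real N" using J2 by (metis of_nat_le_iff of_nat_mult of_nat_numeral of_nat_power)
      then show ?thesis using elim by (simp add: le_log_iff powr_realpow)
    qed
    have J4: "2 * (J + 1) \<le> N"
    proof -
      have "real (2 * (J + 1)) \<le> real N" using J3 elim by simp
      then show ?thesis by (simp only: of_nat_le_iff)
    qed
    define D where "D = nat (a N)"
    have aN: "a N > 0" using pos elim by simp
    have D1: "D \<ge> 1" using aN by (simp add: D_def)
    have inj: "inj_on a {1..N}"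
      using strict_mono_on_imp_inj_on[OF mono] by (rule inj_on_subset) auto
    have bound: "0 \<le> a n \<and> a n \<le> int D" if "n \<in> {1..N}" for n
    proof -
      have "a n \<le> a N"
        using that mono by (cases "n = N") (auto simp: strict_mono_on_def intro!: less_imp_le)
      then show ?thesis using pos that aN by (auto simp: D_def intro: less_imp_le)
    qed
    obtain B where B: "B \<in> sets (unit_interval_from t)"
      "measure (unit_interval_from t) B
        \<le> 64 * 6 ^ k * (1 + log 2 (real (k * (2 * N) * D))) * ln (real N) / real N powr \<eta>"
      "\<And>x. x \<in> {t..t + 1} - B \<Longrightarrow> (real N * star_discrepancy N (\<lambda>n. frac (real_of_int (a n) * x)))\<^sup>2
          \<ge> real N powr (3 - \<kappa> - 3 * \<eta>) / (6144 * pi\<^sup>2 * C * (real J + 1) ^ 3)"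
      using large_discrepancy_off_small_set[OF inj bound D1 E C J1 J2 J4 k k2 \<eta>(2) elim(1), of t] elim by auto
    have "measure (unit_interval_from t) B \<le> b N"
    proof -
      have "real D \<le> C0 * exp (\<gamma> * (ln (real N))\<^sup>2)"
        using C0[of N] elim aN by (simp add: D_def)
      then have "2 * K * real N * real D \<le> 2 * K * real N * (C0 * exp (\<gamma> * (ln (real N))\<^sup>2))"
        using K by (intro mult_left_mono) auto
      then have "real (k * (2 * N) * D) \<le> 2 * K * C0 * real N * exp (\<gamma> * (ln (real N))\<^sup>2)"
        by (simp add: K_def mult_ac)
      moreover have "real (k * (2 * N) * D) > 0" using k D1 elim by simp
      ultimately have "log 2 (real (k * (2 * N) * D)) \<le> log 2 (2 * K * C0 * real N * exp (\<gamma> * (ln (real N))\<^sup>2))"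
        by (intro log_mono) auto
      then have "64 * 6 ^ k * (1 + log 2 (real (k * (2 * N) * D))) * ln (real N) / real N powr \<eta> \<le> b N"
        using elim unfolding b_def by (intro divide_right_mono mult_right_mono mult_left_mono) auto
      then show ?thesis using B(2) by linarith
    qed
    moreover have "real N powr ((3 - \<kappa>) / 2 - 2 * \<eta>) \<le> real N * star_discrepancy N (\<lambda>n. frac (real_of_int (a n) * x))"
      if "x \<in> {t..t + 1} - B" for x
    proof (rule power2_le_imp_le)
      have "6144 * pi\<^sup>2 * C * (real J + 1) ^ 3 \<le> 6144 * pi\<^sup>2 * C * (log 2 (2 * real N) + 2) ^ 3"
        using J3 C by (intro mult_left_mono power_mono) auto
      also have "\<dots> \<le> real N powr \<eta>" by (rule elim)
      finally have le: "6144 * pi\<^sup>2 * C * (real J + 1) ^ 3 \<le> real N powr \<eta>" .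
      have "(real N powr ((3 - \<kappa>) / 2 - 2 * \<eta>))\<^sup>2 = real N powr (3 - \<kappa> - 3 * \<eta>) / real N powr \<eta>"
        unfolding power2_eq_square powr_add[symmetric] powr_diff[symmetric]
        by (intro arg_cong2[where f = "(powr)"] refl) (simp add: field_simps)
      also have "\<dots> \<le> real N powr (3 - \<kappa> - 3 * \<eta>) / (6144 * pi\<^sup>2 * C * (real J + 1) ^ 3)"
        using le C elim by (intro divide_left_mono) auto
      also note B(3)[OF that]
      finally show "(real N powr ((3 - \<kappa>) / 2 - 2 * \<eta>))\<^sup>2
          \<le> (real N * star_discrepancy N (\<lambda>n. frac (real_of_int (a n) * x)))\<^sup>2" .
      show "0 \<le> real N * star_discrepancy N (\<lambda>n. frac (real_of_int (a n) * x))"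
        using star_discrepancy_upper[of 1 N "\<lambda>n. frac (real_of_int (a n) * x)"] by simp
    qed
    ultimately show ?case using B(1) by blast
  qed
  with b0 show thesis using that by blast
qed

section \<open>From exceptional sets to almost every \<alpha>\<close>

text \<open>A point where \<open>Q N\<close> fails for all large \<open>N\<close> lies in a tail
  intersection of the sets \<open>B N\<close>. Such an intersection has measure at most every late
  \<open>b N\<close>, hence 0; so convergence to 0 suffices where Borel-Cantelli would ask for
  summability.\<close>

lemma AE_unit_interval_infinitely_often:
  fixes Q :: "nat \<Rightarrow> real \<Rightarrow> bool" and b :: "nat \<Rightarrow> real"
  assumes b: "b \<longlonglongrightarrow> 0"
    and ev: "eventually (\<lambda>N. \<exists>B\<in>sets (unit_interval_from t). measure (unit_interval_from t) B \<le> b N \<and>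
      (\<forall>x\<in>{t..t + 1} - B. Q N x)) sequentially"
  shows "AE x in lebesgue. x \<in> {t..t + 1} \<longrightarrow> (\<exists>\<^sub>\<infinity>N. Q N x)"
proof -
  let ?M = "unit_interval_from t"
  interpret finite_measure ?M by (rule finite_measure_unit_interval_from)
  obtain N1 where "\<forall>N\<ge>N1. \<exists>B\<in>sets ?M. measure ?M B \<le> b N \<and> (\<forall>x\<in>{t..t + 1} - B. Q N x)"
    using ev unfolding eventually_sequentially by blast
  then obtain B where B: "\<And>N. N \<ge> N1 \<Longrightarrow> B N \<in> sets ?M" "\<And>N. N \<ge> N1 \<Longrightarrow> measure ?M (B N) \<le> b N"
      "\<And>N x. N \<ge> N1 \<Longrightarrow> x \<in> {t..t + 1} - B N \<Longrightarrow> Q N x"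
    by metis
  define Z where "Z = (\<lambda>m. \<Inter>N\<in>{max m N1..}. B N)"
  have Znull: "Z m \<in> null_sets ?M" for m
  proof -
    have Zsets: "Z m \<in> sets ?M"
      unfolding Z_def using B(1) by (intro sets.countable_INT') auto
    have "measure ?M (Z m) \<le> b N" if "N \<ge> max m N1" for N
    proof -
      have "measure ?M (Z m) \<le> measure ?M (B N)"
        using that B(1) by (intro finite_measure_mono) (auto simp: Z_def)
      also have "\<dots> \<le> b N" using that B(2) by simp
      finally show ?thesis .
    qed
    then have "measure ?M (Z m) \<le> 0" by (intro LIMSEQ_le_const[OF b]) blast
    then show ?thesis
      using Zsets by (simp add: null_sets_def emeasure_eq_measure measure_le_0_iff)
  qed
  have "(\<Union>m. Z m) \<in> null_sets ?M" using Znull by (intro null_sets_UN) auto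
  then have "(\<Union>m. Z m) \<in> null_sets lebesgue"
    by (subst (asm) null_sets_restrict_space) auto
  then show ?thesis
  proof (rule AE_I')
    show "{x \<in> space lebesgue. \<not> (x \<in> {t..t + 1} \<longrightarrow> (\<exists>\<^sub>\<infinity>N. Q N x))} \<subseteq> (\<Union>m. Z m)"
    proof
      fix x assume "x \<in> {x \<in> space lebesgue. \<not> (x \<in> {t..t + 1} \<longrightarrow> (\<exists>\<^sub>\<infinity>N. Q N x))}"
      then have x: "x \<in> {t..t + 1}" "\<not> (\<exists>\<^sub>\<infinity>N. Q N x)" by auto
      then obtain m where "\<And>N. N \<ge> m \<Longrightarrow> \<not> Q N x" unfolding INFM_nat_le by blast
      then have "x \<in> Z m" using B(3) x(1) by (force simp: Z_def)
      then show "x \<in> (\<Union>m. Z m)" by blast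
    qed
  qed
qed

theorem theorem1:
  fixes a :: "nat \<Rightarrow> int" and \<gamma> \<kappa> :: real
  assumes "strict_mono_on {1..} a"
    and "\<forall>n\<ge>1. a n > 0"
    and "\<gamma> > 0"
    and "vinogradov_le (\<lambda>n. real_of_int (a n)) (\<lambda>n. exp (\<gamma> * (ln (real n))\<^sup>2))"
    and "\<kappa> \<in> {2..3}"
    and "vinogradov_le (\<lambda>N. real (additive_energy (a ` {1..N}))) (\<lambda>N. real N powr \<kappa>)"
  shows "AE \<alpha> in lebesgue. \<forall>\<epsilon>>0.
           omega_infinitely_often
             (\<lambda>N. real N * star_discrepancy N (\<lambda>n. frac (real_of_int (a n) * \<alpha>)))
             (\<lambda>N. real N powr ((3 - \<kappa>) / 2 - \<epsilon>))"
proof -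
  let ?S = "\<lambda>N \<alpha>. real N * star_discrepancy N (\<lambda>n. frac (real_of_int (a n) * \<alpha>))"
  \<comment> \<open>Only countably many null sets can be united, so the line is cut at the integers
    and \<epsilon> is replaced by the sequence 2 / (m + 1).\<close>
  have "AE \<alpha> in lebesgue. \<alpha> \<in> {real_of_int j..real_of_int j + 1} \<longrightarrow>
      (\<exists>\<^sub>\<infinity>N. real N powr ((3 - \<kappa>) / 2 - 2 * inverse (real (Suc m))) \<le> ?S N \<alpha>)" for j :: int and m
  proof -
    have "0 < inverse (real (Suc m))" "inverse (real (Suc m)) \<le> 1"
      by (auto simp: field_simps)
    from eventually_large_discrepancy[OF assms(1-4,6) this, of "real_of_int j"]
    obtain b where "b \<longlonglongrightarrow> 0" "eventually (\<lambda>N. \<exists>B\<in>sets (unit_interval_from (real_of_int j)).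
        measure (unit_interval_from (real_of_int j)) B \<le> b N \<and>
        (\<forall>x\<in>{real_of_int j..real_of_int j + 1} - B.
          real N powr ((3 - \<kappa>) / 2 - 2 * inverse (real (Suc m))) \<le> ?S N x)) sequentially"
      by blast
    then show ?thesis by (rule AE_unit_interval_infinitely_often)
  qed
  then have "AE \<alpha> in lebesgue. \<forall>j m. \<alpha> \<in> {real_of_int j..real_of_int j + 1} \<longrightarrow>
      (\<exists>\<^sub>\<infinity>N. real N powr ((3 - \<kappa>) / 2 - 2 * inverse (real (Suc m))) \<le> ?S N \<alpha>)"
    by (simp only: AE_all_countable) blast
  then show ?thesis
  proof (rule eventually_mono)
    fix \<alpha> :: real
    assume *: "\<forall>j m. \<alpha> \<in> {real_of_int j..real_of_int j + 1} \<longrightarrow>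
      (\<exists>\<^sub>\<infinity>N. real N powr ((3 - \<kappa>) / 2 - 2 * inverse (real (Suc m))) \<le> ?S N \<alpha>)"
    show "\<forall>\<epsilon>>0. omega_infinitely_often (\<lambda>N. ?S N \<alpha>) (\<lambda>N. real N powr ((3 - \<kappa>) / 2 - \<epsilon>))"
    proof (intro allI impI)
      fix \<epsilon> :: real assume "\<epsilon> > 0"
      then obtain m where m: "inverse (real (Suc m)) < \<epsilon> / 2"
        using reals_Archimedean[of "\<epsilon> / 2"] by auto
      have "\<alpha> \<in> {real_of_int \<lfloor>\<alpha>\<rfloor>..real_of_int \<lfloor>\<alpha>\<rfloor> + 1}" by auto
      with * have inf: "\<exists>\<^sub>\<infinity>N. real N powr ((3 - \<kappa>) / 2 - 2 * inverse (real (Suc m))) \<le> ?S N \<alpha>" by blast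
      have "\<exists>\<^sub>\<infinity>N. 1 * real N powr ((3 - \<kappa>) / 2 - \<epsilon>) \<le> ?S N \<alpha>"
        using inf
      proof (rule INFM_mono)
        fix N assume N: "real N powr ((3 - \<kappa>) / 2 - 2 * inverse (real (Suc m))) \<le> ?S N \<alpha>"
        \<comment> \<open>At \<open>N = 0\<close> both sides are 0, as \<open>0 powr x = 0\<close>;
          otherwise the base is at least 1 and the exponents compare.\<close>
        have "real N powr ((3 - \<kappa>) / 2 - \<epsilon>) \<le> real N powr ((3 - \<kappa>) / 2 - 2 * inverse (real (Suc m)))"
          using m by (cases "N = 0") (auto intro!: powr_mono)
        then show "1 * real N powr ((3 - \<kappa>) / 2 - \<epsilon>) \<le> ?S N \<alpha>" using N by simp
      qed
      then show "omega_infinitely_often (\<lambda>N. ?S N \<alpha>) (\<lambda>N. real N powr ((3 - \<kappa>) / 2 - \<epsilon>))"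
        unfolding omega_infinitely_often_def using zero_less_one by blast
    qed
  qed
qed

end
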